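(* Let $\varphi:R\to S$ be a ring homomorphism. Then $S/R$ is h-separable if and only if it has an h-separability idempotent.
   Context: A functor $F:\mathcal{B}\to\mathcal{A}$ is h-separable (heavily separable) if there are maps $P_{X,Y}:\mathrm{Hom}_{\mathcal{A}}(FX,FY)\to\mathrm{Hom}_{\mathcal{B}}(X,Y)$, natural in $X,Y\in\mathcal{B}$, such that $P_{X,Y}(Ff)=f$ for every $f:X\to Y$ in $\mathcal{B}$, and $P_{X,Z}(f\circ g)=P_{Y,Z}(f)\circ P_{X,Y}(g)$ for all $X,Y,Z\in\mathcal{B}$ and all $g:FX\to FY$, $f:FY\to FZ$ in $\mathcal{A}$. Rings are associative and unital (not necessarily commutative), and ring homomorphisms are unital. Given a ring homomorphism $\varphi:R\to S$, $S/R$ is called h-separable if the restriction of scalars functor $\varphi_{\ast}:S\text{-}\mathrm{Mod}\to R\text{-}\mathrm{Mod}$ (left modules) is h-separable. An h-separability idempotent of $S/R$ is an element $\sum_i a_i\otimes_R b_i\in S\otimes_R S$ such that $\sum_i a_ib_i=1$, $\sum_i sa_i\otimes_R b_i=\sum_i a_i\otimes_R b_is$ for every $s\in S$, and $\sum_{i,j}a_i\otimes_R b_ia_j\otimes_R b_j=\sum_i a_i\otimes_R 1_S\otimes_R b_i$ in $S\otimes_R S\otimes_R S$. *)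

theory Defs
  imports "HOL-Algebra.Module" "HOL-Algebra.Free_Abelian_Groups"
begin

section \<open>Categories, functors and h-separability\<close>

text \<open>
  Arrows do not determine their source and target, so composition and identities carry the
  objects as arguments: \<open>Comp C X Y Z g f\<close> is the composite of \<open>f : X \<rightarrow> Y\<close> and \<open>g : Y \<rightarrow> Z\<close>.
\<close>

record ('o, 'a) cat =
  Obj :: "'o set"
  Hom :: "'o \<Rightarrow> 'o \<Rightarrow> 'a set"
  Comp :: "'o \<Rightarrow> 'o \<Rightarrow> 'o \<Rightarrow> 'a \<Rightarrow> 'a \<Rightarrow> 'a"
  Ident :: "'o \<Rightarrow> 'a"

locale category =
  fixes C :: "('o, 'a) cat"
  assumes comp_closed:
      "\<lbrakk>X \<in> Obj C; Y \<in> Obj C; Z \<in> Obj C; f \<in> Hom C X Y; g \<in> Hom C Y Z\<rbrakk>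
        \<Longrightarrow> Comp C X Y Z g f \<in> Hom C X Z"
    and comp_assoc:
      "\<lbrakk>W \<in> Obj C; X \<in> Obj C; Y \<in> Obj C; Z \<in> Obj C;
        f \<in> Hom C W X; g \<in> Hom C X Y; h \<in> Hom C Y Z\<rbrakk>
        \<Longrightarrow> Comp C W Y Z h (Comp C W X Y g f) = Comp C W X Z (Comp C X Y Z h g) f"
    and ident_closed: "X \<in> Obj C \<Longrightarrow> Ident C X \<in> Hom C X X"
    and ident_left:
      "\<lbrakk>X \<in> Obj C; Y \<in> Obj C; f \<in> Hom C X Y\<rbrakk> \<Longrightarrow> Comp C X Y Y (Ident C Y) f = f"
    and ident_right:
      "\<lbrakk>X \<in> Obj C; Y \<in> Obj C; f \<in> Hom C X Y\<rbrakk> \<Longrightarrow> Comp C X X Y f (Ident C X) = f"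

locale cat_functor = B: category B + A: category A
  for B :: "('o, 'a) cat" and A :: "('p, 'b) cat" +
  fixes Fo :: "'o \<Rightarrow> 'p" and Fa :: "'o \<Rightarrow> 'o \<Rightarrow> 'a \<Rightarrow> 'b"
  assumes obj_closed: "X \<in> Obj B \<Longrightarrow> Fo X \<in> Obj A"
    and arr_closed:
      "\<lbrakk>X \<in> Obj B; Y \<in> Obj B; f \<in> Hom B X Y\<rbrakk> \<Longrightarrow> Fa X Y f \<in> Hom A (Fo X) (Fo Y)"
    and preserves_ident: "X \<in> Obj B \<Longrightarrow> Fa X X (Ident B X) = Ident A (Fo X)"
    and preserves_comp:
      "\<lbrakk>X \<in> Obj B; Y \<in> Obj B; Z \<in> Obj B; f \<in> Hom B X Y; g \<in> Hom B Y Z\<rbrakk>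
        \<Longrightarrow> Fa X Z (Comp B X Y Z g f) = Comp A (Fo X) (Fo Y) (Fo Z) (Fa Y Z g) (Fa X Y f)"

definition h_separable_functor ::
  "('o, 'a) cat \<Rightarrow> ('p, 'b) cat \<Rightarrow> ('o \<Rightarrow> 'p) \<Rightarrow> ('o \<Rightarrow> 'o \<Rightarrow> 'a \<Rightarrow> 'b) \<Rightarrow> bool" where
  "h_separable_functor B A Fo Fa \<longleftrightarrow> cat_functor B A Fo Fa \<and>
    (\<exists>P :: 'o \<Rightarrow> 'o \<Rightarrow> 'b \<Rightarrow> 'a.
      (\<forall>X \<in> Obj B. \<forall>Y \<in> Obj B. P X Y \<in> Hom A (Fo X) (Fo Y) \<rightarrow> Hom B X Y) \<and>
      \<comment> \<open>naturality in both variables\<close>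
      (\<forall>X \<in> Obj B. \<forall>Y \<in> Obj B. \<forall>X' \<in> Obj B. \<forall>Y' \<in> Obj B.
        \<forall>u \<in> Hom B X' X. \<forall>v \<in> Hom B Y Y'. \<forall>f \<in> Hom A (Fo X) (Fo Y).
          P X' Y' (Comp A (Fo X') (Fo Y) (Fo Y') (Fa Y Y' v)
                     (Comp A (Fo X') (Fo X) (Fo Y) f (Fa X' X u)))
          = Comp B X' Y Y' v (Comp B X' X Y (P X Y f) u)) \<and>
      (\<forall>X \<in> Obj B. \<forall>Y \<in> Obj B. \<forall>f \<in> Hom B X Y. P X Y (Fa X Y f) = f) \<and>
      (\<forall>X \<in> Obj B. \<forall>Y \<in> Obj B. \<forall>Z \<in> Obj B.
        \<forall>g \<in> Hom A (Fo X) (Fo Y). \<forall>f \<in> Hom A (Fo Y) (Fo Z).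
          P X Z (Comp A (Fo X) (Fo Y) (Fo Z) f g) = Comp B X Y Z (P Y Z f) (P X Y g)))"


section \<open>Left modules over not necessarily commutative rings\<close>

text \<open>
  The locale \<open>module\<close> of the library requires a commutative ring; the record type \<open>module\<close> is
  reused, its ring fields \<open>mult\<close> and \<open>one\<close> being irrelevant.
\<close>

locale left_module = R?: ring R + M?: abelian_group M
  for R :: "('r, 'x) ring_scheme" (structure) and M :: "('r, 'm) module" (structure) +
  assumes smult_closed:
      "\<lbrakk>a \<in> carrier R; x \<in> carrier M\<rbrakk> \<Longrightarrow> a \<odot>\<^bsub>M\<^esub> x \<in> carrier M"
    and smult_l_distr:
      "\<lbrakk>a \<in> carrier R; b \<in> carrier R; x \<in> carrier M\<rbrakk>
        \<Longrightarrow> (a \<oplus>\<^bsub>R\<^esub> b) \<odot>\<^bsub>M\<^esub> x = a \<odot>\<^bsub>M\<^esub> x \<oplus>\<^bsub>M\<^esub> b \<odot>\<^bsub>M\<^esub> x"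
    and smult_r_distr:
      "\<lbrakk>a \<in> carrier R; x \<in> carrier M; y \<in> carrier M\<rbrakk>
        \<Longrightarrow> a \<odot>\<^bsub>M\<^esub> (x \<oplus>\<^bsub>M\<^esub> y) = a \<odot>\<^bsub>M\<^esub> x \<oplus>\<^bsub>M\<^esub> a \<odot>\<^bsub>M\<^esub> y"
    and smult_assoc:
      "\<lbrakk>a \<in> carrier R; b \<in> carrier R; x \<in> carrier M\<rbrakk>
        \<Longrightarrow> (a \<otimes>\<^bsub>R\<^esub> b) \<odot>\<^bsub>M\<^esub> x = a \<odot>\<^bsub>M\<^esub> (b \<odot>\<^bsub>M\<^esub> x)"
    and smult_one: "x \<in> carrier M \<Longrightarrow> \<one>\<^bsub>R\<^esub> \<odot>\<^bsub>M\<^esub> x = x"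

text \<open>
  Homomorphisms are extensional functions, so that equality of homomorphisms is equality in HOL.
\<close>

definition lin_maps ::
  "('r, 'x) ring_scheme \<Rightarrow> ('r, 'm) module \<Rightarrow> ('r, 'n) module \<Rightarrow> ('m \<Rightarrow> 'n) set" where
  "lin_maps R M N = {f \<in> carrier M \<rightarrow>\<^sub>E carrier N.
     (\<forall>x \<in> carrier M. \<forall>y \<in> carrier M. f (x \<oplus>\<^bsub>M\<^esub> y) = f x \<oplus>\<^bsub>N\<^esub> f y) \<and>
     (\<forall>r \<in> carrier R. \<forall>x \<in> carrier M. f (r \<odot>\<^bsub>M\<^esub> x) = r \<odot>\<^bsub>N\<^esub> f x)}"

text \<open>
  The category of left \<open>R\<close>-modules whose underlying sets are subsets of the type \<open>'u\<close>.
  The type \<open>'u\<close> plays the role of the universe in which modules are formed; HOL cannot quantify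
  over types inside a formula. A universe containing \<open>S\<close> is infinite and has a subset in bijection
  with \<open>S\<close>; this ensures that it has room for copies of \<open>S\<close>, \<open>S \<otimes>\<^sub>R S\<close> and \<open>S \<otimes>\<^sub>R S \<otimes>\<^sub>R S\<close>.
\<close>

definition module_cat ::
  "('r, 'x) ring_scheme \<Rightarrow> (('r, 'u) module, 'u \<Rightarrow> 'u) cat" where
  "module_cat R = \<lparr>Obj = {M. left_module R M}, Hom = lin_maps R,
     Comp = (\<lambda>X Y Z g f. compose (carrier X) g f), Ident = (\<lambda>X. \<lambda>x \<in> carrier X. x)\<rparr>"

definition restrict_scalars :: "('r \<Rightarrow> 's) \<Rightarrow> ('s, 'm) module \<Rightarrow> ('r, 'm) module" where
  "restrict_scalars \<phi> M = \<lparr>carrier = carrier M, monoid.mult = monoid.mult M, one = one M,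
     ring.zero = ring.zero M, ring.add = ring.add M, smult = (\<lambda>r x. \<phi> r \<odot>\<^bsub>M\<^esub> x)\<rparr>"

text \<open>On homomorphisms, restriction of scalars does not change the underlying function.\<close>

definition h_separable_extension ::
  "'u itself \<Rightarrow> ('r, 'x) ring_scheme \<Rightarrow> ('s, 'y) ring_scheme \<Rightarrow> ('r \<Rightarrow> 's) \<Rightarrow> bool" where
  "h_separable_extension _ R S \<phi> \<longleftrightarrow>
     h_separable_functor
       (module_cat S :: (('s, 'u) module, 'u \<Rightarrow> 'u) cat)
       (module_cat R :: (('r, 'u) module, 'u \<Rightarrow> 'u) cat)
       (restrict_scalars \<phi>) (\<lambda>X Y f. f)"


section \<open>Tensor products\<close>

text \<open>
  The tensor product of a right module \<open>M\<close> and a left module \<open>N\<close> over \<open>R\<close>, as the quotient of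
  the free abelian group on pairs by the subgroup generated by the balancing relations. The right
  module \<open>M\<close> is stored in a record of type \<open>module\<close> in which \<open>r \<odot>\<^bsub>M\<^esub> m\<close> stands for \<open>m r\<close>.
  The resulting group is written multiplicatively, as free abelian groups are in the library.
\<close>

definition tensor_rels ::
  "('r, 'x) ring_scheme \<Rightarrow> ('r, 'm) module \<Rightarrow> ('r, 'n) module \<Rightarrow> ('m \<times> 'n \<Rightarrow>\<^sub>0 int) set" where
  "tensor_rels R M N =
     {frag_of (m \<oplus>\<^bsub>M\<^esub> m', n) - frag_of (m, n) - frag_of (m', n) | m m' n.
        m \<in> carrier M \<and> m' \<in> carrier M \<and> n \<in> carrier N} \<union>
     {frag_of (m, n \<oplus>\<^bsub>N\<^esub> n') - frag_of (m, n) - frag_of (m, n') | m n n'.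
        m \<in> carrier M \<and> n \<in> carrier N \<and> n' \<in> carrier N} \<union>
     {frag_of (r \<odot>\<^bsub>M\<^esub> m, n) - frag_of (m, r \<odot>\<^bsub>N\<^esub> n) | r m n.
        r \<in> carrier R \<and> m \<in> carrier M \<and> n \<in> carrier N}"

definition tensor_kernel ::
  "('r, 'x) ring_scheme \<Rightarrow> ('r, 'm) module \<Rightarrow> ('r, 'n) module \<Rightarrow> ('m \<times> 'n \<Rightarrow>\<^sub>0 int) set" where
  "tensor_kernel R M N =
     generate (free_Abelian_group (carrier M \<times> carrier N)) (tensor_rels R M N)"

definition tensor_group ::
  "('r, 'x) ring_scheme \<Rightarrow> ('r, 'm) module \<Rightarrow> ('r, 'n) module \<Rightarrow> ('m \<times> 'n \<Rightarrow>\<^sub>0 int) set monoid" where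
  "tensor_group R M N =
     free_Abelian_group (carrier M \<times> carrier N) Mod tensor_kernel R M N"

definition tensor_coset ::
  "('r, 'x) ring_scheme \<Rightarrow> ('r, 'm) module \<Rightarrow> ('r, 'n) module
     \<Rightarrow> ('m \<times> 'n \<Rightarrow>\<^sub>0 int) \<Rightarrow> ('m \<times> 'n \<Rightarrow>\<^sub>0 int) set" where
  "tensor_coset R M N x =
     tensor_kernel R M N #>\<^bsub>free_Abelian_group (carrier M \<times> carrier N)\<^esub> x"

definition left_regular :: "('s, 'y) ring_scheme \<Rightarrow> ('s, 's) module" where
  "left_regular S = \<lparr>carrier = carrier S, monoid.mult = monoid.mult S, one = one S,
     ring.zero = ring.zero S, ring.add = ring.add S, smult = (\<lambda>s x. s \<otimes>\<^bsub>S\<^esub> x)\<rparr>"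

text \<open>\<open>S\<close> as a right \<open>R\<close>-module via \<open>\<phi>\<close>.\<close>

definition right_restricted :: "('s, 'y) ring_scheme \<Rightarrow> ('r \<Rightarrow> 's) \<Rightarrow> ('r, 's) module" where
  "right_restricted S \<phi> = \<lparr>carrier = carrier S, monoid.mult = monoid.mult S, one = one S,
     ring.zero = ring.zero S, ring.add = ring.add S, smult = (\<lambda>r x. x \<otimes>\<^bsub>S\<^esub> \<phi> r)\<rparr>"

text \<open>
  For a left \<open>S\<close>-module \<open>N\<close>, the left \<open>S\<close>-module \<open>S \<otimes>\<^sub>R N\<close>, with \<open>s (a \<otimes> n) = (s a) \<otimes> n\<close>.
  The action of \<open>s\<close> on a coset adds the kernel to the pushforwards of its representatives; the
  result is a single coset because the pushforward preserves the kernel.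
\<close>

definition S_tensor ::
  "('r, 'x) ring_scheme \<Rightarrow> ('s, 'y) ring_scheme \<Rightarrow> ('r \<Rightarrow> 's) \<Rightarrow> ('s, 'n) module
     \<Rightarrow> ('s, ('s \<times> 'n \<Rightarrow>\<^sub>0 int) set) module" where
  "S_tensor R S \<phi> N =
     (let M = right_restricted S \<phi>; N' = restrict_scalars \<phi> N; T = tensor_group R M N' in
      \<lparr>carrier = carrier T, monoid.mult = undefined, one = undefined,
       ring.zero = monoid.one T, ring.add = monoid.mult T,
       smult = (\<lambda>s X. \<Union>x \<in> X.
         tensor_coset R M N' (frag_extend (\<lambda>(a, n). frag_of (s \<otimes>\<^bsub>S\<^esub> a, n)) x))\<rparr>)"

definition S_pure ::
  "('r, 'x) ring_scheme \<Rightarrow> ('s, 'y) ring_scheme \<Rightarrow> ('r \<Rightarrow> 's) \<Rightarrow> ('s, 'n) module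
     \<Rightarrow> 's \<Rightarrow> 'n \<Rightarrow> ('s \<times> 'n \<Rightarrow>\<^sub>0 int) set" where
  "S_pure R S \<phi> N a n =
     tensor_coset R (right_restricted S \<phi>) (restrict_scalars \<phi> N) (frag_of (a, n))"

abbreviation SS ::
  "('r, 'x) ring_scheme \<Rightarrow> ('s, 'y) ring_scheme \<Rightarrow> ('r \<Rightarrow> 's)
     \<Rightarrow> ('s, ('s \<times> 's \<Rightarrow>\<^sub>0 int) set) module" where
  "SS R S \<phi> \<equiv> S_tensor R S \<phi> (left_regular S)"

text \<open>The triple tensor product is bracketed as \<open>S \<otimes>\<^sub>R (S \<otimes>\<^sub>R S)\<close>.\<close>

abbreviation SSS ::
  "('r, 'x) ring_scheme \<Rightarrow> ('s, 'y) ring_scheme \<Rightarrow> ('r \<Rightarrow> 's)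
     \<Rightarrow> ('s, ('s \<times> ('s \<times> 's \<Rightarrow>\<^sub>0 int) set \<Rightarrow>\<^sub>0 int) set) module" where
  "SSS R S \<phi> \<equiv> S_tensor R S \<phi> (SS R S \<phi>)"

abbreviation pure2 ::
  "('r, 'x) ring_scheme \<Rightarrow> ('s, 'y) ring_scheme \<Rightarrow> ('r \<Rightarrow> 's)
     \<Rightarrow> 's \<Rightarrow> 's \<Rightarrow> ('s \<times> 's \<Rightarrow>\<^sub>0 int) set" where
  "pure2 R S \<phi> a b \<equiv> S_pure R S \<phi> (left_regular S) a b"

abbreviation pure3 ::
  "('r, 'x) ring_scheme \<Rightarrow> ('s, 'y) ring_scheme \<Rightarrow> ('r \<Rightarrow> 's)
     \<Rightarrow> 's \<Rightarrow> 's \<Rightarrow> 's \<Rightarrow> ('s \<times> ('s \<times> 's \<Rightarrow>\<^sub>0 int) set \<Rightarrow>\<^sub>0 int) set" where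
  "pure3 R S \<phi> a b c \<equiv> S_pure R S \<phi> (SS R S \<phi>) a (pure2 R S \<phi> b c)"

definition h_separability_idempotent ::
  "('r, 'x) ring_scheme \<Rightarrow> ('s, 'y) ring_scheme \<Rightarrow> ('r \<Rightarrow> 's)
     \<Rightarrow> ('s \<times> 's \<Rightarrow>\<^sub>0 int) set \<Rightarrow> bool" where
  "h_separability_idempotent R S \<phi> e \<longleftrightarrow>
    (\<exists>(n :: nat) a b. a \<in> {..<n} \<rightarrow> carrier S \<and> b \<in> {..<n} \<rightarrow> carrier S \<and>
      e = (\<Oplus>\<^bsub>SS R S \<phi>\<^esub>i\<in>{..<n}. pure2 R S \<phi> (a i) (b i)) \<and>
      (\<Oplus>\<^bsub>S\<^esub>i\<in>{..<n}. a i \<otimes>\<^bsub>S\<^esub> b i) = \<one>\<^bsub>S\<^esub> \<and>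
      (\<forall>s \<in> carrier S.
        (\<Oplus>\<^bsub>SS R S \<phi>\<^esub>i\<in>{..<n}. pure2 R S \<phi> (s \<otimes>\<^bsub>S\<^esub> a i) (b i))
        = (\<Oplus>\<^bsub>SS R S \<phi>\<^esub>i\<in>{..<n}. pure2 R S \<phi> (a i) (b i \<otimes>\<^bsub>S\<^esub> s))) \<and>
      (\<Oplus>\<^bsub>SSS R S \<phi>\<^esub>i\<in>{..<n}. \<Oplus>\<^bsub>SSS R S \<phi>\<^esub>j\<in>{..<n}.
         pure3 R S \<phi> (a i) (b i \<otimes>\<^bsub>S\<^esub> a j) (b j))
      = (\<Oplus>\<^bsub>SSS R S \<phi>\<^esub>i\<in>{..<n}. pure3 R S \<phi> (a i) \<one>\<^bsub>S\<^esub> (b i)))"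

end

theory Submission
  imports Defs
begin

text \<open>
The idea is that of the Yoneda lemma. A family of maps \<open>P\<close> which exhibits restriction of scalars
as h-separable is determined by its value on one \<open>R\<close>-linear map, the unit
\<open>\<eta> : S \<rightarrow> S \<otimes>\<^sub>R S\<close> with \<open>\<eta>(x) = 1 \<otimes> x\<close>. The \<open>S\<close>-linear map
\<open>P(\<eta>)\<close> is in turn determined by the element \<open>e = P(\<eta>)(1)\<close> of \<open>S \<otimes>\<^sub>R S\<close>, and the
conditions on \<open>P\<close> and on \<open>e\<close> correspond to each other.

In one direction (lemma \<open>idempotent_of_retraction\<close>), the law \<open>P(f) = f\<close> for \<open>S\<close>-linear
\<open>f\<close>, applied to the composite of \<open>\<eta>\<close> with multiplication, shows that \<open>e\<close> multiplies to
\<open>1\<close>; naturality with respect to right multiplications shows that \<open>e\<close> is central; and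
multiplicativity of \<open>P\<close> on the composite \<open>S \<rightarrow> S \<otimes>\<^sub>R S \<rightarrow> S \<otimes>\<^sub>R S \<otimes>\<^sub>R S\<close> of two
units gives the identity in the triple tensor product. In the other direction (lemma
\<open>retraction_of_idempotent\<close>), \<open>P(f)(x) = \<Sum> a\<^sub>i f(b\<^sub>i x)\<close> has the required properties.

Two preparations make this precise. The functoriality conditions reduce to the three laws of the
locale \<open>retraction\<close>, since naturality follows from multiplicativity together with
\<open>P(f) = f\<close> on \<open>S\<close>-linear maps. Moreover \<open>P\<close> only sees modules on subsets of the universe
type, so \<open>S\<close> and its tensor powers have to be replaced by copies there. That there is room for
them is a cardinality count (lemma \<open>S_tensor_lepoll\<close>), and the lemmas on \<open>transport\<close> carry the
laws of \<open>P\<close> over to the original modules. Tensor products enter only through their universal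
property and the fact that pure tensors generate them.
\<close>

section \<open>Additive maps\<close>

definition additive_map :: "('a, 'x) ring_scheme \<Rightarrow> ('b, 'y) ring_scheme \<Rightarrow> ('a \<Rightarrow> 'b) \<Rightarrow> bool" where
  "additive_map M L f \<longleftrightarrow> f \<in> carrier M \<rightarrow> carrier L \<and>
     (\<forall>x \<in> carrier M. \<forall>y \<in> carrier M. f (x \<oplus>\<^bsub>M\<^esub> y) = f x \<oplus>\<^bsub>L\<^esub> f y)"

lemma additive_mapI:
  assumes "\<And>x. x \<in> carrier M \<Longrightarrow> f x \<in> carrier L"
    and "\<And>x y. \<lbrakk>x \<in> carrier M; y \<in> carrier M\<rbrakk> \<Longrightarrow> f (x \<oplus>\<^bsub>M\<^esub> y) = f x \<oplus>\<^bsub>L\<^esub> f y"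
  shows "additive_map M L f"
  using assms by (auto simp: additive_map_def)

lemma additive_map_closed: "additive_map M L f \<Longrightarrow> x \<in> carrier M \<Longrightarrow> f x \<in> carrier L"
  by (auto simp: additive_map_def)

lemma additive_map_add:
  "\<lbrakk>additive_map M L f; x \<in> carrier M; y \<in> carrier M\<rbrakk> \<Longrightarrow> f (x \<oplus>\<^bsub>M\<^esub> y) = f x \<oplus>\<^bsub>L\<^esub> f y"
  by (auto simp: additive_map_def)

lemma additive_map_zero:
  assumes "abelian_group M" "abelian_group L" "additive_map M L f"
  shows "f \<zero>\<^bsub>M\<^esub> = \<zero>\<^bsub>L\<^esub>"
proof -
  interpret M: abelian_group M by fact
  interpret L: abelian_group L by fact
  have "f \<zero>\<^bsub>M\<^esub> \<oplus>\<^bsub>L\<^esub> f \<zero>\<^bsub>M\<^esub> = f \<zero>\<^bsub>M\<^esub> \<oplus>\<^bsub>L\<^esub> \<zero>\<^bsub>L\<^esub>"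
    using additive_map_add[OF assms(3), of "\<zero>\<^bsub>M\<^esub>" "\<zero>\<^bsub>M\<^esub>"] additive_map_closed[OF assms(3)] by simp
  then show ?thesis
    using additive_map_closed[OF assms(3), of "\<zero>\<^bsub>M\<^esub>"] by simp
qed

lemma additive_map_finsum:
  assumes "abelian_group M" "abelian_group L" "additive_map M L h" "f \<in> A \<rightarrow> carrier M"
  shows "h (\<Oplus>\<^bsub>M\<^esub>i\<in>A. f i) = (\<Oplus>\<^bsub>L\<^esub>i\<in>A. h (f i))"
proof -
  interpret M: abelian_group M by fact
  interpret L: abelian_group L by fact
  note cl = additive_map_closed[OF assms(3)]
  show ?thesis
    using assms(4)
  proof (induction A rule: infinite_finite_induct)
    case (insert i A)
    have "h (\<Oplus>\<^bsub>M\<^esub>i\<in>insert i A. f i) = h (f i \<oplus>\<^bsub>M\<^esub> (\<Oplus>\<^bsub>M\<^esub>i\<in>A. f i))"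
      using insert by (subst M.finsum_insert) auto
    also have "\<dots> = h (f i) \<oplus>\<^bsub>L\<^esub> h (\<Oplus>\<^bsub>M\<^esub>i\<in>A. f i)"
      using insert.prems by (intro additive_map_add[OF assms(3)] M.finsum_closed) auto
    also have "\<dots> = h (f i) \<oplus>\<^bsub>L\<^esub> (\<Oplus>\<^bsub>L\<^esub>i\<in>A. h (f i))"
      using insert by (auto simp: Pi_def)
    also have "\<dots> = (\<Oplus>\<^bsub>L\<^esub>i\<in>insert i A. h (f i))"
      using insert cl by (subst L.finsum_insert) auto
    finally show ?case .
  qed (use additive_map_zero[OF assms(1-3)] in auto)
qed

section \<open>Generation and universal property of the tensor product\<close>

lemma tensor_rels_cases:
  assumes "x \<in> tensor_rels R M N"
  obtains
    (add_left) m m' n where "m \<in> carrier M" "m' \<in> carrier M" "n \<in> carrier N"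
      "x = frag_of (m \<oplus>\<^bsub>M\<^esub> m', n) - frag_of (m, n) - frag_of (m', n)"
  | (add_right) m n n' where "m \<in> carrier M" "n \<in> carrier N" "n' \<in> carrier N"
      "x = frag_of (m, n \<oplus>\<^bsub>N\<^esub> n') - frag_of (m, n) - frag_of (m, n')"
  | (balanced) r m n where "r \<in> carrier R" "m \<in> carrier M" "n \<in> carrier N"
      "x = frag_of (r \<odot>\<^bsub>M\<^esub> m, n) - frag_of (m, r \<odot>\<^bsub>N\<^esub> n)"
  using assms unfolding tensor_rels_def
  by (elim UnE CollectE exE conjE) ((rule that; assumption)+)

text \<open>
Closure under the two actions puts the balancing relations into the free abelian group.
\<close>

locale balanced_modules =
  fixes R :: "('r, 'x) ring_scheme" and M :: "('r, 'm) module" and N :: "('r, 'n) module"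
  assumes abelian_left: "abelian_group M"
    and abelian_right: "abelian_group N"
    and left_action: "\<lbrakk>r \<in> carrier R; m \<in> carrier M\<rbrakk> \<Longrightarrow> r \<odot>\<^bsub>M\<^esub> m \<in> carrier M"
    and right_action: "\<lbrakk>r \<in> carrier R; n \<in> carrier N\<rbrakk> \<Longrightarrow> r \<odot>\<^bsub>N\<^esub> n \<in> carrier N"
begin

abbreviation F where "F \<equiv> free_Abelian_group (carrier M \<times> carrier N)"
abbreviation K where "K \<equiv> tensor_kernel R M N"
abbreviation T where "T \<equiv> tensor_group R M N"

definition pure :: "'m \<Rightarrow> 'n \<Rightarrow> ('m \<times> 'n \<Rightarrow>\<^sub>0 int) set" where
  "pure m n = tensor_coset R M N (frag_of (m, n))"

sublocale M: abelian_group M by (rule abelian_left)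
sublocale N: abelian_group N by (rule abelian_right)
sublocale F: comm_group F by (rule abelian_free_Abelian_group)

lemma rels_subset: "tensor_rels R M N \<subseteq> carrier F"
  unfolding tensor_rels_def
  by (auto simp: left_action right_action dest!: subsetD[OF keys_diff])

lemma kernel_normal: "K \<lhd> F"
  unfolding tensor_kernel_def
  by (intro F.subgroup_imp_normal F.generate_is_subgroup rels_subset)

lemma kernel_subgroup: "subgroup K F"
  using kernel_normal by (rule normal_imp_subgroup)

sublocale T: comm_group T
proof -
  interpret normal K F by (rule kernel_normal)
  show "comm_group T"
    unfolding tensor_group_def
    by (rule F.abelian_FactGroup) (rule kernel_subgroup)
qed

lemma coset_add:
  assumes "x \<in> carrier F" "y \<in> carrier F"
  shows "tensor_coset R M N (x + y) = tensor_coset R M N x \<otimes>\<^bsub>T\<^esub> tensor_coset R M N y"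
  using normal.rcos_sum[OF kernel_normal assms]
  by (simp add: tensor_coset_def tensor_group_def)

lemma coset_closed: "x \<in> carrier F \<Longrightarrow> tensor_coset R M N x \<in> carrier T"
  by (auto simp: tensor_coset_def tensor_group_def carrier_FactGroup)

lemma coset_cases:
  assumes "X \<in> carrier T"
  obtains x where "x \<in> carrier F" "X = tensor_coset R M N x"
  using assms by (auto simp: tensor_coset_def tensor_group_def carrier_FactGroup)

lemma coset_zero: "tensor_coset R M N 0 = \<one>\<^bsub>T\<^esub>"
  using F.coset_mult_one[of K] kernel_subgroup subgroup.subset
  by (auto simp: tensor_coset_def tensor_group_def)

lemma coset_diff:
  assumes "x \<in> carrier F" "y \<in> carrier F"
  shows "tensor_coset R M N (x - y)
    = tensor_coset R M N x \<otimes>\<^bsub>T\<^esub> inv\<^bsub>T\<^esub> tensor_coset R M N y"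
proof -
  have xy: "x - y \<in> carrier F"
    using assms by (auto dest!: subsetD[OF keys_diff])
  have "tensor_coset R M N (x - y) \<otimes>\<^bsub>T\<^esub> tensor_coset R M N y = tensor_coset R M N x"
    using coset_add[OF xy assms(2)] by simp
  then show ?thesis
    using assms xy by (metis T.inv_solve_right coset_closed)
qed

lemma coset_eqI:
  assumes "x \<in> carrier F" "y \<in> carrier F" "x - y \<in> K"
  shows "tensor_coset R M N x = tensor_coset R M N y"
proof -
  have "x = (x - y) \<otimes>\<^bsub>F\<^esub> y" by simp
  then have "x \<in> K #>\<^bsub>F\<^esub> y"
    unfolding r_coset_def using assms(3) by blast
  then show ?thesis
    unfolding tensor_coset_def using F.repr_independence assms(2) kernel_subgroup by metis
qed

lemma pure_closed: "\<lbrakk>m \<in> carrier M; n \<in> carrier N\<rbrakk> \<Longrightarrow> pure m n \<in> carrier T"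
  unfolding pure_def by (rule coset_closed) simp

lemma rels_kernel: "x \<in> tensor_rels R M N \<Longrightarrow> x \<in> K"
  unfolding tensor_kernel_def by (rule generate.incl)

lemma pure_add_left:
  assumes "m \<in> carrier M" "m' \<in> carrier M" "n \<in> carrier N"
  shows "pure (m \<oplus>\<^bsub>M\<^esub> m') n = pure m n \<otimes>\<^bsub>T\<^esub> pure m' n"
proof -
  have "frag_of (m \<oplus>\<^bsub>M\<^esub> m', n) - frag_of (m, n) - frag_of (m', n) \<in> tensor_rels R M N"
    unfolding tensor_rels_def using assms by blast
  then have "frag_of (m \<oplus>\<^bsub>M\<^esub> m', n) - (frag_of (m, n) + frag_of (m', n)) \<in> K"
    by (simp add: rels_kernel diff_diff_eq)
  moreover have "frag_of (m, n) + frag_of (m', n) \<in> carrier F"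
    using assms by (auto dest!: subsetD[OF keys_add])
  ultimately have "pure (m \<oplus>\<^bsub>M\<^esub> m') n = tensor_coset R M N (frag_of (m, n) + frag_of (m', n))"
    unfolding pure_def using assms by (intro coset_eqI) auto
  also have "\<dots> = pure m n \<otimes>\<^bsub>T\<^esub> pure m' n"
    unfolding pure_def using assms by (intro coset_add) auto
  finally show ?thesis .
qed

lemma pure_add_right:
  assumes "m \<in> carrier M" "n \<in> carrier N" "n' \<in> carrier N"
  shows "pure m (n \<oplus>\<^bsub>N\<^esub> n') = pure m n \<otimes>\<^bsub>T\<^esub> pure m n'"
proof -
  have "frag_of (m, n \<oplus>\<^bsub>N\<^esub> n') - frag_of (m, n) - frag_of (m, n') \<in> tensor_rels R M N"
    unfolding tensor_rels_def using assms by blast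
  then have "frag_of (m, n \<oplus>\<^bsub>N\<^esub> n') - (frag_of (m, n) + frag_of (m, n')) \<in> K"
    by (simp add: rels_kernel diff_diff_eq)
  moreover have "frag_of (m, n) + frag_of (m, n') \<in> carrier F"
    using assms by (auto dest!: subsetD[OF keys_add])
  ultimately have "pure m (n \<oplus>\<^bsub>N\<^esub> n') = tensor_coset R M N (frag_of (m, n) + frag_of (m, n'))"
    unfolding pure_def using assms by (intro coset_eqI) auto
  also have "\<dots> = pure m n \<otimes>\<^bsub>T\<^esub> pure m n'"
    unfolding pure_def using assms by (intro coset_add) auto
  finally show ?thesis .
qed

lemma pure_balanced:
  assumes "r \<in> carrier R" "m \<in> carrier M" "n \<in> carrier N"
  shows "pure (r \<odot>\<^bsub>M\<^esub> m) n = pure m (r \<odot>\<^bsub>N\<^esub> n)"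
proof -
  have "frag_of (r \<odot>\<^bsub>M\<^esub> m, n) - frag_of (m, r \<odot>\<^bsub>N\<^esub> n) \<in> tensor_rels R M N"
    unfolding tensor_rels_def using assms by blast
  then show ?thesis
    unfolding pure_def using assms left_action right_action
    by (intro coset_eqI rels_kernel) auto
qed

lemma pure_zero_left:
  assumes "n \<in> carrier N" shows "pure \<zero>\<^bsub>M\<^esub> n = \<one>\<^bsub>T\<^esub>"
  using pure_add_left[of "\<zero>\<^bsub>M\<^esub>" "\<zero>\<^bsub>M\<^esub>" n] assms pure_closed[of "\<zero>\<^bsub>M\<^esub>" n] by simp

lemma pure_minus_left:
  assumes "m \<in> carrier M" "n \<in> carrier N"
  shows "inv\<^bsub>T\<^esub> pure m n = pure (\<ominus>\<^bsub>M\<^esub> m) n"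
  using pure_add_left[of "\<ominus>\<^bsub>M\<^esub> m" m n] assms
  by (intro T.inv_equality) (auto simp: M.l_neg pure_zero_left pure_closed)

text \<open>
Every tensor is a finite sum of pure tensors. The free abelian group also contains differences, but
no subtraction is needed in the induction step, since \<open>-(m \<otimes> n) = (-m) \<otimes> n\<close>. The proof
strengthens the claim to adding or subtracting a coset, because the induction on the free abelian
group goes through differences.
\<close>

lemma tensor_induct [consumes 1, case_names zero pure]:
  assumes "X \<in> carrier T"
    and zero: "P \<one>\<^bsub>T\<^esub>"
    and pure: "\<And>m n Y. \<lbrakk>m \<in> carrier M; n \<in> carrier N; Y \<in> carrier T; P Y\<rbrakk>
      \<Longrightarrow> P (pure m n \<otimes>\<^bsub>T\<^esub> Y)"
  shows "P X"
proof -
  define Q where "Q x \<longleftrightarrow> (\<forall>Y \<in> carrier T. P Y \<longrightarrow>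
      P (tensor_coset R M N x \<otimes>\<^bsub>T\<^esub> Y) \<and> P (inv\<^bsub>T\<^esub> tensor_coset R M N x \<otimes>\<^bsub>T\<^esub> Y))" for x
  obtain x where x: "x \<in> carrier F" "X = tensor_coset R M N x"
    using assms(1) by (rule coset_cases)
  have "Poly_Mapping.keys x \<subseteq> carrier M \<times> carrier N"
    using x(1) by simp
  then have "Q x"
  proof (induction x rule: free_Abelian_group_induct[consumes 1, case_names zero diff of])
    case zero
    then show ?case by (simp add: Q_def coset_zero)
  next
    case (diff x y)
    have xy: "tensor_coset R M N x \<in> carrier T" "tensor_coset R M N y \<in> carrier T"
      using diff(1,2) by (auto intro: coset_closed)
    have d: "tensor_coset R M N (x - y)
        = tensor_coset R M N x \<otimes>\<^bsub>T\<^esub> inv\<^bsub>T\<^esub> tensor_coset R M N y"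
      using diff(1,2) by (intro coset_diff) auto
    show ?case
      unfolding Q_def d
    proof (intro ballI impI conjI)
      fix Y assume Y: "Y \<in> carrier T" "P Y"
      have "P (tensor_coset R M N x \<otimes>\<^bsub>T\<^esub> (inv\<^bsub>T\<^esub> tensor_coset R M N y \<otimes>\<^bsub>T\<^esub> Y))"
        using diff(3,4) Y xy unfolding Q_def by simp
      then show "P (tensor_coset R M N x \<otimes>\<^bsub>T\<^esub> inv\<^bsub>T\<^esub> tensor_coset R M N y \<otimes>\<^bsub>T\<^esub> Y)"
        using xy Y by (simp add: T.m_assoc)
      have "P (tensor_coset R M N y \<otimes>\<^bsub>T\<^esub> (inv\<^bsub>T\<^esub> tensor_coset R M N x \<otimes>\<^bsub>T\<^esub> Y))"
        using diff(3,4) Y xy unfolding Q_def by simp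
      then show "P (inv\<^bsub>T\<^esub> (tensor_coset R M N x \<otimes>\<^bsub>T\<^esub> inv\<^bsub>T\<^esub> tensor_coset R M N y) \<otimes>\<^bsub>T\<^esub> Y)"
        using xy Y by (simp add: T.inv_mult_group T.m_assoc)
    qed
  next
    case (of p)
    then obtain m n where p: "p = (m, n)" "m \<in> carrier M" "n \<in> carrier N" by auto
    show ?case
      unfolding Q_def p(1) pure_def[symmetric]
      using p assms(3) by (auto simp: pure_minus_left)
  qed
  then have "P (X \<otimes>\<^bsub>T\<^esub> \<one>\<^bsub>T\<^esub>)"
    unfolding Q_def using x zero by simp
  then show ?thesis using assms(1) by simp
qed

text \<open>
The universal property: a balanced biadditive map extends to the free abelian group, kills the
balancing relations and hence the subgroup that they generate, and so descends to the quotient.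
\<close>

lemma tensor_universal:
  fixes L :: "('l, 'z) ring_scheme" and f :: "'m \<Rightarrow> 'n \<Rightarrow> 'l"
  assumes L: "abelian_group L"
    and f: "\<And>n. n \<in> carrier N \<Longrightarrow> additive_map M L (\<lambda>m. f m n)"
      "\<And>m. m \<in> carrier M \<Longrightarrow> additive_map N L (f m)"
    and f_balanced: "\<And>r m n. \<lbrakk>r \<in> carrier R; m \<in> carrier M; n \<in> carrier N\<rbrakk>
      \<Longrightarrow> f (r \<odot>\<^bsub>M\<^esub> m) n = f m (r \<odot>\<^bsub>N\<^esub> n)"
  obtains h where "h \<in> hom T (add_monoid L)"
    and "\<And>m n. \<lbrakk>m \<in> carrier M; n \<in> carrier N\<rbrakk> \<Longrightarrow> h (pure m n) = f m n"
proof -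
  interpret L: abelian_group L by (rule L)
  have f_closed: "\<And>m n. \<lbrakk>m \<in> carrier M; n \<in> carrier N\<rbrakk> \<Longrightarrow> f m n \<in> carrier L"
    using f(2) by (rule additive_map_closed)
  have "(\<lambda>(m, n). f m n) ` (carrier M \<times> carrier N) \<subseteq> carrier L"
    using f_closed by auto
  then obtain h0 where h0: "h0 \<in> hom F (add_monoid L)"
    and h0_of: "\<And>p. p \<in> carrier M \<times> carrier N \<Longrightarrow> h0 (frag_of p) = (case p of (m, n) \<Rightarrow> f m n)"
    by (rule L.add.free_Abelian_group_universal) blast
  interpret h0: group_hom F "add_monoid L" h0
    by (rule group_hom.intro[OF F.is_group L.add.is_group group_hom_axioms.intro[OF h0]])
  have diffc: "x - y \<in> carrier F" if "x \<in> carrier F" "y \<in> carrier F" for x y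
    using that by (auto dest!: subsetD[OF keys_diff])
  have h0_closed: "h0 x \<in> carrier L" if "x \<in> carrier F" for x
    using h0.hom_closed[OF that] by simp
  have diff: "h0 (x - y) = h0 x \<ominus>\<^bsub>L\<^esub> h0 y" if "x \<in> carrier F" "y \<in> carrier F" for x y
  proof -
    have "h0 ((x - y) \<otimes>\<^bsub>F\<^esub> y) = h0 (x - y) \<otimes>\<^bsub>add_monoid L\<^esub> h0 y"
      using diffc[OF that] that(2) by (rule h0.hom_mult)
    then have "h0 x = h0 (x - y) \<oplus>\<^bsub>L\<^esub> h0 y"
      by simp
    then show ?thesis
      using h0_closed[OF diffc[OF that]] h0_closed[OF that(2)]
      by (simp add: a_minus_def L.a_assoc L.r_neg)
  qed
  have cancel: "a \<oplus>\<^bsub>L\<^esub> b \<ominus>\<^bsub>L\<^esub> a \<ominus>\<^bsub>L\<^esub> b = \<zero>\<^bsub>L\<^esub>" if "a \<in> carrier L" "b \<in> carrier L" for a b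
    using that by (simp add: a_minus_def L.a_assoc L.r_neg L.a_lcomm[of a])
  have "tensor_rels R M N \<subseteq> kernel F (add_monoid L) h0"
  proof
    fix x assume x: "x \<in> tensor_rels R M N"
    then have "h0 x = \<zero>\<^bsub>L\<^esub>"
    proof (cases rule: tensor_rels_cases)
      case (add_left m m' n)
      then have "h0 x = f (m \<oplus>\<^bsub>M\<^esub> m') n \<ominus>\<^bsub>L\<^esub> f m n \<ominus>\<^bsub>L\<^esub> f m' n"
        using diffc by (simp add: diff h0_of del: carrier_free_Abelian_group_iff)
      with add_left show ?thesis
        using additive_map_add[OF f(1)] by (simp add: f_closed cancel)
    next
      case (add_right m n n')
      then have "h0 x = f m (n \<oplus>\<^bsub>N\<^esub> n') \<ominus>\<^bsub>L\<^esub> f m n \<ominus>\<^bsub>L\<^esub> f m n'"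
        using diffc by (simp add: diff h0_of del: carrier_free_Abelian_group_iff)
      with add_right show ?thesis
        by (simp add: f_closed cancel additive_map_add[OF f(2)])
    next
      case (balanced r m n)
      then have "h0 x = f (r \<odot>\<^bsub>M\<^esub> m) n \<ominus>\<^bsub>L\<^esub> f m (r \<odot>\<^bsub>N\<^esub> n)"
        by (simp add: diff h0_of left_action right_action del: carrier_free_Abelian_group_iff)
      with balanced show ?thesis
        by (simp add: f_closed f_balanced right_action a_minus_def L.r_neg)
    qed
    with x rels_subset show "x \<in> kernel F (add_monoid L) h0"
      unfolding kernel_def by (simp add: subset_eq del: carrier_free_Abelian_group_iff)
  qed
  then have "K \<subseteq> kernel F (add_monoid L) h0"
    unfolding tensor_kernel_def by (rule F.generate_subgroup_incl) (rule h0.subgroup_kernel)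
  then obtain h where "h \<in> hom (F Mod K) (add_monoid L)"
    and "\<And>x. x \<in> carrier F \<Longrightarrow> h (K #>\<^bsub>F\<^esub> x) = h0 x"
    by (rule h0.FactGroup_universal_kernel[OF kernel_normal]) blast
  then show thesis
    using h0_of by (intro that[of h]) (auto simp: tensor_group_def pure_def tensor_coset_def)
qed

text \<open>
An \<open>R\<close>-linear endomorphism of the left factor maps balancing relations to balancing relations.
This makes the action of \<open>S\<close> on \<open>S \<otimes>\<^sub>R N\<close> well defined.
\<close>

lemma frag_map_kernel:
  assumes \<alpha>: "additive_map M M \<alpha>"
    and lin: "\<And>r m. \<lbrakk>r \<in> carrier R; m \<in> carrier M\<rbrakk> \<Longrightarrow> \<alpha> (r \<odot>\<^bsub>M\<^esub> m) = r \<odot>\<^bsub>M\<^esub> \<alpha> m"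
  defines "p \<equiv> frag_extend (\<lambda>(m, n). frag_of (\<alpha> m, n))"
  shows "\<And>x. x \<in> carrier F \<Longrightarrow> p x \<in> carrier F" and "\<And>x. x \<in> K \<Longrightarrow> p x \<in> K"
proof -
  have p_diff: "p (x - y) = p x - p y" and p_add: "p (x + y) = p x + p y"
    and p_of: "p (frag_of (m, n)) = frag_of (\<alpha> m, n)" for x y m n
    by (simp_all add: p_def frag_extend_diff frag_extend_add)
  note \<alpha>_closed = additive_map_closed[OF \<alpha>]
  show closed: "p x \<in> carrier F" if "x \<in> carrier F" for x
    using that \<alpha>_closed unfolding p_def
    by (auto dest!: subsetD[OF keys_frag_extend] split: prod.splits)
  have "subgroup {x \<in> carrier F. p x \<in> K} F"
  proof (rule F.subgroupI)
    show "{x \<in> carrier F. p x \<in> K} \<noteq> {}"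
      using subgroup.one_closed[OF kernel_subgroup] by (auto simp: p_def intro!: exI[of _ 0])
  next
    fix x assume "x \<in> {x \<in> carrier F. p x \<in> K}"
    then show "inv\<^bsub>F\<^esub> x \<in> {x \<in> carrier F. p x \<in> K}"
      using subgroup.m_inv_closed[OF kernel_subgroup, of "p x"] closed[of x]
      by (simp add: p_def frag_extend_minus)
  next
    fix x y assume xy: "x \<in> {x \<in> carrier F. p x \<in> K}" "y \<in> {x \<in> carrier F. p x \<in> K}"
    then show "x \<otimes>\<^bsub>F\<^esub> y \<in> {x \<in> carrier F. p x \<in> K}"
      using subgroup.m_closed[OF kernel_subgroup, of "p x" "p y"] F.m_closed[of x y]
      by (simp add: p_add)
  qed auto
  moreover have "tensor_rels R M N \<subseteq> {x \<in> carrier F. p x \<in> K}"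
  proof
    fix x assume x: "x \<in> tensor_rels R M N"
    then have "p x \<in> tensor_rels R M N"
    proof (cases rule: tensor_rels_cases)
      case (add_left m m' n)
      then have "p x = frag_of (\<alpha> m \<oplus>\<^bsub>M\<^esub> \<alpha> m', n) - frag_of (\<alpha> m, n) - frag_of (\<alpha> m', n)"
        by (simp add: p_diff p_of additive_map_add[OF \<alpha>])
      with add_left \<alpha>_closed show ?thesis unfolding tensor_rels_def by blast
    next
      case (add_right m n n')
      then have "p x = frag_of (\<alpha> m, n \<oplus>\<^bsub>N\<^esub> n') - frag_of (\<alpha> m, n) - frag_of (\<alpha> m, n')"
        by (simp add: p_diff p_of)
      with add_right \<alpha>_closed show ?thesis unfolding tensor_rels_def by blast
    next
      case (balanced r m n)
      then have "p x = frag_of (r \<odot>\<^bsub>M\<^esub> \<alpha> m, n) - frag_of (\<alpha> m, r \<odot>\<^bsub>N\<^esub> n)"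
        by (simp add: p_diff p_of lin)
      with balanced \<alpha>_closed show ?thesis unfolding tensor_rels_def by blast
    qed
    then show "x \<in> {x \<in> carrier F. p x \<in> K}"
      using x rels_subset rels_kernel by blast
  qed
  ultimately have "K \<subseteq> {x \<in> carrier F. p x \<in> K}"
    unfolding tensor_kernel_def by (intro F.generate_subgroup_incl)
  then show "p x \<in> K" if "x \<in> K" for x
    using that by blast
qed

end

section \<open>Linear maps\<close>

lemma lin_mapsI:
  assumes "\<And>x. x \<in> carrier M \<Longrightarrow> f x \<in> carrier N"
    and "\<And>x y. \<lbrakk>x \<in> carrier M; y \<in> carrier M\<rbrakk> \<Longrightarrow> f (x \<oplus>\<^bsub>M\<^esub> y) = f x \<oplus>\<^bsub>N\<^esub> f y"
    and "\<And>r x. \<lbrakk>r \<in> carrier R; x \<in> carrier M\<rbrakk> \<Longrightarrow> f (r \<odot>\<^bsub>M\<^esub> x) = r \<odot>\<^bsub>N\<^esub> f x"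
    and "f \<in> extensional (carrier M)"
  shows "f \<in> lin_maps R M N"
  using assms by (auto simp: lin_maps_def PiE_def)

lemma lin_maps_closed: "f \<in> lin_maps R M N \<Longrightarrow> x \<in> carrier M \<Longrightarrow> f x \<in> carrier N"
  by (auto simp: lin_maps_def)

lemma lin_maps_add:
  "\<lbrakk>f \<in> lin_maps R M N; x \<in> carrier M; y \<in> carrier M\<rbrakk> \<Longrightarrow> f (x \<oplus>\<^bsub>M\<^esub> y) = f x \<oplus>\<^bsub>N\<^esub> f y"
  by (auto simp: lin_maps_def)

lemma lin_maps_smult:
  "\<lbrakk>f \<in> lin_maps R M N; r \<in> carrier R; x \<in> carrier M\<rbrakk> \<Longrightarrow> f (r \<odot>\<^bsub>M\<^esub> x) = r \<odot>\<^bsub>N\<^esub> f x"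
  by (auto simp: lin_maps_def)

lemma lin_maps_extensional: "f \<in> lin_maps R M N \<Longrightarrow> f \<in> extensional (carrier M)"
  by (auto simp: lin_maps_def PiE_def)

lemma lin_maps_additive: "f \<in> lin_maps R M N \<Longrightarrow> additive_map M N f"
  by (auto simp: lin_maps_def additive_map_def)

lemma lin_maps_ext:
  assumes "f \<in> lin_maps R M N" "g \<in> lin_maps R' M N'" "\<And>x. x \<in> carrier M \<Longrightarrow> f x = g x"
  shows "f = g"
  using assms by (intro extensionalityI[of _ "carrier M"] lin_maps_extensional)

lemma lin_maps_compose:
  assumes "left_module R M" "f \<in> lin_maps R M N" "g \<in> lin_maps R N L"
  shows "compose (carrier M) g f \<in> lin_maps R M L"
proof -
  interpret M: left_module R M by fact
  show ?thesis
    using assms(2,3) by (auto simp: lin_maps_def compose_def PiE_iff M.smult_closed)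
qed

lemma abelian_group_transfer:
  assumes "abelian_group L" "carrier L' = carrier L" "add L' = add L" "ring.zero L' = ring.zero L"
  shows "abelian_group L'"
  using abelian_groupE[OF assms(1)] assms(2-4) by (intro abelian_groupI) simp_all

section \<open>Base change along a ring homomorphism\<close>

locale ring_extension = R: ring R + S: ring S
  for R :: "('r, 'x) ring_scheme" and S :: "('s, 'y) ring_scheme" +
  fixes \<phi> :: "'r \<Rightarrow> 's"
  assumes phi_hom: "\<phi> \<in> ring_hom R S"
begin

lemma phi_closed [simp]: "r \<in> carrier R \<Longrightarrow> \<phi> r \<in> carrier S"
  using phi_hom by (rule ring_hom_closed)

lemma left_regular_simps [simp]:
  "carrier (left_regular S) = carrier S" "add (left_regular S) = add S"
  "ring.zero (left_regular S) = ring.zero S" "s \<odot>\<^bsub>left_regular S\<^esub> x = s \<otimes>\<^bsub>S\<^esub> x"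
  by (simp_all add: left_regular_def)

lemma right_restricted_simps [simp]:
  "carrier (right_restricted S \<phi>) = carrier S" "add (right_restricted S \<phi>) = add S"
  "ring.zero (right_restricted S \<phi>) = ring.zero S"
  "r \<odot>\<^bsub>right_restricted S \<phi>\<^esub> x = x \<otimes>\<^bsub>S\<^esub> \<phi> r"
  by (simp_all add: right_restricted_def)

lemma restrict_scalars_simps [simp]:
  "carrier (restrict_scalars \<phi> M) = carrier M" "add (restrict_scalars \<phi> M) = add M"
  "ring.zero (restrict_scalars \<phi> M) = ring.zero M"
  "r \<odot>\<^bsub>restrict_scalars \<phi> M\<^esub> x = \<phi> r \<odot>\<^bsub>M\<^esub> x"
  by (simp_all add: restrict_scalars_def)

lemma left_regular_module: "left_module S (left_regular S)"
proof -
  have "abelian_group (left_regular S)"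
    by (rule abelian_group_transfer[OF S.abelian_group_axioms]) simp_all
  then show ?thesis
    by (intro left_module.intro left_module_axioms.intro S.ring_axioms)
      (simp_all add: S.l_distr S.r_distr S.m_assoc)
qed

lemma restrict_scalars_module:
  assumes "left_module S M"
  shows "left_module R (restrict_scalars \<phi> M)"
proof -
  interpret M: left_module S M by fact
  have "abelian_group (restrict_scalars \<phi> M)"
    by (rule abelian_group_transfer[OF M.abelian_group_axioms]) simp_all
  then show ?thesis
    by (intro left_module.intro left_module_axioms.intro R.ring_axioms)
      (simp_all add: ring_hom_add[OF phi_hom] ring_hom_mult[OF phi_hom] ring_hom_one[OF phi_hom]
        M.smult_closed M.smult_l_distr M.smult_r_distr M.smult_assoc M.smult_one)
qed

lemma balanced_modules:
  assumes "left_module S N"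
  shows "balanced_modules R (right_restricted S \<phi>) (restrict_scalars \<phi> N)"
proof -
  interpret N: left_module S N by fact
  show ?thesis
    by (intro balanced_modules.intro abelian_group_transfer[OF S.abelian_group_axioms]
        abelian_group_transfer[OF N.abelian_group_axioms]) (simp_all add: N.smult_closed)
qed

text \<open>
The tensor products of interest all have the form \<open>S \<otimes>\<^sub>R N\<close>, written \<open>ST N\<close>,
with pure tensors \<open>SP N a n\<close>. The lemmas of the following block are the whole interface to the
construction; the quotient of the free abelian group is not unfolded afterwards.
\<close>

abbreviation ST where "ST \<equiv> S_tensor R S \<phi>"
abbreviation SP where "SP \<equiv> S_pure R S \<phi>"

context
  fixes N :: "('s, 'n) module"
  assumes N: "left_module S N"
begin

interpretation B: balanced_modules R "right_restricted S \<phi>" "restrict_scalars \<phi> N"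
  by (rule balanced_modules[OF N])

private abbreviation coset where
  "coset \<equiv> tensor_coset R (right_restricted S \<phi>) (restrict_scalars \<phi> N)"
private abbreviation push where
  "push s \<equiv> frag_extend (\<lambda>(a, n). frag_of (s \<otimes>\<^bsub>S\<^esub> a, n))"

private lemma S_tensor_simps:
  "carrier (ST N) = carrier B.T" "add (ST N) = monoid.mult B.T" "ring.zero (ST N) = one B.T"
  by (simp_all add: S_tensor_def Let_def)

private lemma S_pure_eq: "SP N a n = B.pure a n"
  by (simp add: S_pure_def B.pure_def)

private lemma push_closed:
  assumes "s \<in> carrier S"
  shows "x \<in> carrier B.F \<Longrightarrow> push s x \<in> carrier B.F" and "x \<in> B.K \<Longrightarrow> push s x \<in> B.K"
proof -
  have "additive_map (right_restricted S \<phi>) (right_restricted S \<phi>) (\<lambda>a. s \<otimes>\<^bsub>S\<^esub> a)"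
    using assms by (intro additive_mapI) (simp_all add: S.r_distr)
  moreover have "s \<otimes>\<^bsub>S\<^esub> (r \<odot>\<^bsub>right_restricted S \<phi>\<^esub> m) = r \<odot>\<^bsub>right_restricted S \<phi>\<^esub> (s \<otimes>\<^bsub>S\<^esub> m)"
    if "r \<in> carrier R" "m \<in> carrier (right_restricted S \<phi>)" for r m
    using that assms by (simp add: S.m_assoc)
  ultimately show "x \<in> carrier B.F \<Longrightarrow> push s x \<in> carrier B.F" "x \<in> B.K \<Longrightarrow> push s x \<in> B.K"
    using B.frag_map_kernel[of "\<lambda>a. s \<otimes>\<^bsub>S\<^esub> a" x] by blast+
qed

text \<open>
The action is defined by a union over all representatives of a coset. They differ by elements of the
kernel, which the pushforward preserves, so they all contribute the same coset.
\<close>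

private lemma smult_coset:
  assumes s: "s \<in> carrier S" and x: "x \<in> carrier B.F"
  shows "s \<odot>\<^bsub>ST N\<^esub> coset x = coset (push s x)"
proof -
  have "coset (push s y) = coset (push s x)" if y: "y \<in> coset x" for y
  proof -
    obtain k where k: "k \<in> B.K" "y = k + x"
      using y unfolding tensor_coset_def r_coset_def mult_free_Abelian_group by blast
    then have "y \<in> carrier B.F"
      using x B.F.m_closed[of k x] subgroup.subset[OF B.kernel_subgroup]
      by (simp add: subset_eq del: carrier_free_Abelian_group_iff)
    moreover have "push s y - push s x \<in> B.K"
      using k push_closed(2)[OF s] by (simp add: frag_extend_add)
    ultimately show ?thesis
      using push_closed(1)[OF s] x by (intro B.coset_eqI)
  qed
  moreover have "x \<in> coset x"
    unfolding tensor_coset_def using x B.kernel_subgroup by (rule B.F.rcos_self)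
  ultimately have "(\<Union>y\<in>coset x. coset (push s y)) = coset (push s x)"
    by blast
  then show ?thesis
    by (simp add: S_tensor_def Let_def)
qed

private lemma S_tensor_abelian: "abelian_group (ST N)"
  by (rule abelian_groupI; unfold S_tensor_simps;
      rule comm_groupE[OF B.T.comm_group_axioms]; assumption)

private lemma S_tensor_smult_closed:
  assumes "s \<in> carrier S" "X \<in> carrier (ST N)"
  shows "s \<odot>\<^bsub>ST N\<^esub> X \<in> carrier (ST N)"
  using assms(2) unfolding S_tensor_simps
  by (elim B.coset_cases) (simp only: smult_coset assms(1) push_closed(1) B.coset_closed)

private lemma S_tensor_smult_add:
  assumes "s \<in> carrier S" "X \<in> carrier (ST N)" "Y \<in> carrier (ST N)"
  shows "s \<odot>\<^bsub>ST N\<^esub> (X \<oplus>\<^bsub>ST N\<^esub> Y) = s \<odot>\<^bsub>ST N\<^esub> X \<oplus>\<^bsub>ST N\<^esub> s \<odot>\<^bsub>ST N\<^esub> Y"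
proof -
  obtain x y where x: "x \<in> carrier B.F" "X = coset x" and y: "y \<in> carrier B.F" "Y = coset y"
    using assms(2,3) B.coset_cases unfolding S_tensor_simps by metis
  have xy: "x + y \<in> carrier B.F"
    using B.F.m_closed[OF x(1) y(1)] by (simp only: mult_free_Abelian_group)
  have "X \<oplus>\<^bsub>ST N\<^esub> Y = coset (x + y)"
    using x y B.coset_add by (simp only: S_tensor_simps)
  then have "s \<odot>\<^bsub>ST N\<^esub> (X \<oplus>\<^bsub>ST N\<^esub> Y) = coset (push s x + push s y)"
    using smult_coset[OF assms(1) xy] by (simp only: frag_extend_add)
  also have "\<dots> = coset (push s x) \<otimes>\<^bsub>B.T\<^esub> coset (push s y)"
    using push_closed(1)[OF assms(1)] x y by (intro B.coset_add)
  finally show ?thesis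
    using smult_coset[OF assms(1)] x y by (simp only: S_tensor_simps)
qed

lemma S_pure_closed: "\<lbrakk>a \<in> carrier S; n \<in> carrier N\<rbrakk> \<Longrightarrow> SP N a n \<in> carrier (ST N)"
  using B.pure_closed[of a n] by (simp add: S_pure_eq S_tensor_simps)

lemma S_pure_add_left:
  "\<lbrakk>a \<in> carrier S; a' \<in> carrier S; n \<in> carrier N\<rbrakk>
    \<Longrightarrow> SP N (a \<oplus>\<^bsub>S\<^esub> a') n = SP N a n \<oplus>\<^bsub>ST N\<^esub> SP N a' n"
  using B.pure_add_left[of a a' n] by (simp add: S_pure_eq S_tensor_simps)

lemma S_pure_add_right:
  "\<lbrakk>a \<in> carrier S; n \<in> carrier N; n' \<in> carrier N\<rbrakk>
    \<Longrightarrow> SP N a (n \<oplus>\<^bsub>N\<^esub> n') = SP N a n \<oplus>\<^bsub>ST N\<^esub> SP N a n'"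
  using B.pure_add_right[of a n n'] by (simp add: S_pure_eq S_tensor_simps)

lemma S_pure_balanced:
  "\<lbrakk>r \<in> carrier R; a \<in> carrier S; n \<in> carrier N\<rbrakk>
    \<Longrightarrow> SP N (a \<otimes>\<^bsub>S\<^esub> \<phi> r) n = SP N a (\<phi> r \<odot>\<^bsub>N\<^esub> n)"
  using B.pure_balanced[of r a n] by (simp add: S_pure_eq S_tensor_simps)

lemma S_pure_smult:
  "\<lbrakk>s \<in> carrier S; a \<in> carrier S; n \<in> carrier N\<rbrakk>
    \<Longrightarrow> s \<odot>\<^bsub>ST N\<^esub> SP N a n = SP N (s \<otimes>\<^bsub>S\<^esub> a) n"
  using smult_coset[of s "frag_of (a, n)"] by (simp add: S_pure_def)

lemma S_tensor_induct [consumes 1, case_names zero pure]: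
  assumes "X \<in> carrier (ST N)"
    and "P \<zero>\<^bsub>ST N\<^esub>"
    and "\<And>a n Y. \<lbrakk>a \<in> carrier S; n \<in> carrier N; Y \<in> carrier (ST N); P Y\<rbrakk>
      \<Longrightarrow> P (SP N a n \<oplus>\<^bsub>ST N\<^esub> Y)"
  shows "P X"
  using assms B.tensor_induct[of X P] unfolding S_tensor_simps S_pure_eq by simp

lemma S_tensor_module: "left_module S (ST N)"
proof -
  interpret ST: abelian_group "ST N" by (rule S_tensor_abelian)
  note closed = S_pure_closed S_tensor_smult_closed
  have zero: "s \<odot>\<^bsub>ST N\<^esub> \<zero>\<^bsub>ST N\<^esub> = \<zero>\<^bsub>ST N\<^esub>" if "s \<in> carrier S" for s
    using that by (intro additive_map_zero[OF S_tensor_abelian S_tensor_abelian] additive_mapI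
        S_tensor_smult_closed S_tensor_smult_add)
  show ?thesis
  proof (intro left_module.intro left_module_axioms.intro S.ring_axioms S_tensor_abelian
      S_tensor_smult_closed S_tensor_smult_add)
    fix s t X assume st: "s \<in> carrier S" "t \<in> carrier S" and X: "X \<in> carrier (ST N)"
    show "(s \<oplus>\<^bsub>S\<^esub> t) \<odot>\<^bsub>ST N\<^esub> X = s \<odot>\<^bsub>ST N\<^esub> X \<oplus>\<^bsub>ST N\<^esub> t \<odot>\<^bsub>ST N\<^esub> X"
      using X
    proof (induction X rule: S_tensor_induct)
      case (pure a n Y)
      then show ?case
        using st by (simp add: S_tensor_smult_add S_pure_smult S_pure_closed closed S.l_distr
            S_pure_add_left
            ST.a_ac)
    qed (simp add: zero st)
    show "(s \<otimes>\<^bsub>S\<^esub> t) \<odot>\<^bsub>ST N\<^esub> X = s \<odot>\<^bsub>ST N\<^esub> (t \<odot>\<^bsub>ST N\<^esub> X)"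
      using X
    proof (induction X rule: S_tensor_induct)
      case (pure a n Y)
      then show ?case
        using st by (simp add: S_tensor_smult_add S_pure_smult closed S.m_assoc)
    qed (simp add: zero st)
  next
    fix X assume "X \<in> carrier (ST N)"
    then show "\<one>\<^bsub>S\<^esub> \<odot>\<^bsub>ST N\<^esub> X = X"
      by (induction X rule: S_tensor_induct)
        (simp_all add: zero S_tensor_smult_add S_pure_smult closed)
  qed
qed

text \<open>
The universal property of \<open>S \<otimes>\<^sub>R N\<close> among left \<open>S\<close>-modules. All maps out of tensor
products below are obtained from it.
\<close>

lemma S_tensor_lift:
  fixes L :: "('s, 'l) module"
  assumes L: "left_module S L"
    and f_closed: "\<And>a n. \<lbrakk>a \<in> carrier S; n \<in> carrier N\<rbrakk> \<Longrightarrow> f a n \<in> carrier L"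
    and f_add: "\<And>a n n'. \<lbrakk>a \<in> carrier S; n \<in> carrier N; n' \<in> carrier N\<rbrakk>
      \<Longrightarrow> f a (n \<oplus>\<^bsub>N\<^esub> n') = f a n \<oplus>\<^bsub>L\<^esub> f a n'"
    and f_add_left: "\<And>a a' n. \<lbrakk>a \<in> carrier S; a' \<in> carrier S; n \<in> carrier N\<rbrakk>
      \<Longrightarrow> f (a \<oplus>\<^bsub>S\<^esub> a') n = f a n \<oplus>\<^bsub>L\<^esub> f a' n"
    and f_balanced: "\<And>r a n. \<lbrakk>r \<in> carrier R; a \<in> carrier S; n \<in> carrier N\<rbrakk>
      \<Longrightarrow> f (a \<otimes>\<^bsub>S\<^esub> \<phi> r) n = f a (\<phi> r \<odot>\<^bsub>N\<^esub> n)"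
    and f_smult: "\<And>s a n. \<lbrakk>s \<in> carrier S; a \<in> carrier S; n \<in> carrier N\<rbrakk>
      \<Longrightarrow> f (s \<otimes>\<^bsub>S\<^esub> a) n = s \<odot>\<^bsub>L\<^esub> f a n"
  obtains h where "h \<in> lin_maps S (ST N) L"
    and "\<And>a n. \<lbrakk>a \<in> carrier S; n \<in> carrier N\<rbrakk> \<Longrightarrow> h (SP N a n) = f a n"
proof -
  interpret L: left_module S L by (rule L)
  interpret ST: left_module S "ST N" by (rule S_tensor_module)
  obtain h0 where h0: "h0 \<in> Group.hom B.T (add_monoid L)"
    and h0_pure: "\<And>a n. \<lbrakk>a \<in> carrier S; n \<in> carrier N\<rbrakk> \<Longrightarrow> h0 (SP N a n) = f a n"
    by (rule B.tensor_universal[of L f])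
      (simp_all add: L.abelian_group_axioms additive_map_def f_closed f_add f_add_left
        f_balanced S_pure_eq)
  define h where "h = restrict h0 (carrier (ST N))"
  have h_pure: "h (SP N a n) = f a n" if "a \<in> carrier S" "n \<in> carrier N" for a n
    using that by (simp add: h_def S_pure_closed h0_pure)
  have h_closed: "h X \<in> carrier L" if "X \<in> carrier (ST N)" for X
    using that hom_in_carrier[OF h0] by (simp add: h_def S_tensor_simps)
  have h_add: "h (X \<oplus>\<^bsub>ST N\<^esub> Y) = h X \<oplus>\<^bsub>L\<^esub> h Y"
    if "X \<in> carrier (ST N)" "Y \<in> carrier (ST N)" for X Y
    using that hom_mult[OF h0, of X Y] ST.a_closed[OF that] by (simp add: h_def S_tensor_simps)
  have zero: "h \<zero>\<^bsub>ST N\<^esub> = \<zero>\<^bsub>L\<^esub>"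
    by (rule additive_map_zero[OF ST.abelian_group_axioms L.abelian_group_axioms])
      (simp add: additive_mapI h_closed h_add)
  have smult_zero: "s \<odot>\<^bsub>L\<^esub> \<zero>\<^bsub>L\<^esub> = \<zero>\<^bsub>L\<^esub>" if "s \<in> carrier S" for s
    by (rule additive_map_zero[OF L.abelian_group_axioms L.abelian_group_axioms])
      (simp add: additive_mapI that L.smult_closed L.smult_r_distr)
  have smult_zero': "s \<odot>\<^bsub>ST N\<^esub> \<zero>\<^bsub>ST N\<^esub> = \<zero>\<^bsub>ST N\<^esub>" if "s \<in> carrier S" for s
    by (rule additive_map_zero[OF ST.abelian_group_axioms ST.abelian_group_axioms])
      (simp add: additive_mapI that ST.smult_closed ST.smult_r_distr)
  have "h (s \<odot>\<^bsub>ST N\<^esub> X) = s \<odot>\<^bsub>L\<^esub> h X" if s: "s \<in> carrier S" and X: "X \<in> carrier (ST N)" for s X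
    using X
  proof (induction X rule: S_tensor_induct)
    case (pure a n Y)
    have "s \<odot>\<^bsub>ST N\<^esub> (SP N a n \<oplus>\<^bsub>ST N\<^esub> Y) = SP N (s \<otimes>\<^bsub>S\<^esub> a) n \<oplus>\<^bsub>ST N\<^esub> s \<odot>\<^bsub>ST N\<^esub> Y"
      using s pure by (simp add: ST.smult_r_distr S_pure_closed S_pure_smult)
    then show ?case
      using s pure by (simp add: h_add h_pure h_closed S_pure_closed ST.smult_closed L.smult_r_distr
          f_closed f_smult)
  qed (simp add: s zero smult_zero smult_zero')
  then have "h \<in> lin_maps S (ST N) L"
    by (intro lin_mapsI) (simp_all add: h_closed h_add, simp add: h_def)
  then show thesis
    using h_pure by (rule that)
qed

end

end

context ring_extension begin

lemma S_tensor_map: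
  assumes N: "left_module S N" and N': "left_module S N'" and u: "u \<in> lin_maps S N N'"
  obtains h where "h \<in> lin_maps S (ST N) (ST N')"
    and "\<And>a n. \<lbrakk>a \<in> carrier S; n \<in> carrier N\<rbrakk> \<Longrightarrow> h (SP N a n) = SP N' a (u n)"
  by (rule S_tensor_lift[OF N S_tensor_module[OF N'], of "\<lambda>a n. SP N' a (u n)"])
    (use that in \<open>simp_all add: lin_maps_closed[OF u] lin_maps_add[OF u] lin_maps_smult[OF u]
      S_pure_closed[OF N'] S_pure_add_left[OF N'] S_pure_add_right[OF N'] S_pure_balanced[OF N']
      S_pure_smult[OF N']\<close>)

text \<open>
The unit \<open>n \<mapsto> 1 \<otimes> n\<close> of the adjunction between \<open>S \<otimes>\<^sub>R -\<close> and restriction of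
scalars. It is \<open>R\<close>-linear because \<open>1 \<otimes> \<phi>(r) n = \<phi>(r) \<otimes> n\<close>, but not \<open>S\<close>-linear in
general.
\<close>

lemma S_tensor_unit:
  assumes N: "left_module S N"
  shows "(\<lambda>n\<in>carrier N. SP N \<one>\<^bsub>S\<^esub> n)
    \<in> lin_maps R (restrict_scalars \<phi> N) (restrict_scalars \<phi> (ST N))"
proof -
  interpret N: left_module S N by (rule N)
  show ?thesis
  proof (rule lin_mapsI)
    fix r n assume "r \<in> carrier R" "n \<in> carrier (restrict_scalars \<phi> N)"
    then show "(\<lambda>n\<in>carrier N. SP N \<one>\<^bsub>S\<^esub> n) (r \<odot>\<^bsub>restrict_scalars \<phi> N\<^esub> n)
        = r \<odot>\<^bsub>restrict_scalars \<phi> (ST N)\<^esub> (\<lambda>n\<in>carrier N. SP N \<one>\<^bsub>S\<^esub> n) n"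
      using S_pure_balanced[OF N, of r "\<one>\<^bsub>S\<^esub>" n]
      by (simp add: S_pure_smult[OF N] N.smult_closed)
  qed (simp_all add: S_pure_closed[OF N] S_pure_add_right[OF N])
qed

lemma S_tensor_finite_sum:
  assumes N: "left_module S N" and X: "X \<in> carrier (ST N)"
  obtains k :: nat and a n where "a \<in> {..<k} \<rightarrow> carrier S" "n \<in> {..<k} \<rightarrow> carrier N"
    "X = (\<Oplus>\<^bsub>ST N\<^esub>i\<in>{..<k}. SP N (a i) (n i))"
proof -
  interpret ST: left_module S "ST N" by (rule S_tensor_module[OF N])
  have "\<exists>k::nat. \<exists>a n. a \<in> {..<k} \<rightarrow> carrier S \<and> n \<in> {..<k} \<rightarrow> carrier N \<and>
    X = (\<Oplus>\<^bsub>ST N\<^esub>i\<in>{..<k}. SP N (a i) (n i))"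
    using X
  proof (induction X rule: S_tensor_induct[OF N, consumes 1, case_names zero pure])
    case zero
    have "\<zero>\<^bsub>ST N\<^esub> = (\<Oplus>\<^bsub>ST N\<^esub>i\<in>{..<0::nat}. SP N (a i) (n i))" for a n
      by simp
    then show ?case by (intro exI[of _ 0]) auto
  next
    case (pure c m Y)
    then obtain k :: nat and a n where a: "a \<in> {..<k} \<rightarrow> carrier S"
      and n: "n \<in> {..<k} \<rightarrow> carrier N" and Y: "Y = (\<Oplus>\<^bsub>ST N\<^esub>i\<in>{..<k}. SP N (a i) (n i))"
      by blast
    define a' n' where "a' = a(k := c)" and "n' = n(k := m)"
    have a': "a' \<in> {..<Suc k} \<rightarrow> carrier S" and n': "n' \<in> {..<Suc k} \<rightarrow> carrier N"
      using a n pure(1,2) by (auto simp: a'_def n'_def less_Suc_eq)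
    have "(\<Oplus>\<^bsub>ST N\<^esub>i\<in>{..<Suc k}. SP N (a' i) (n' i))
        = SP N (a' k) (n' k) \<oplus>\<^bsub>ST N\<^esub> (\<Oplus>\<^bsub>ST N\<^esub>i\<in>{..<k}. SP N (a' i) (n' i))"
      using a' n' S_pure_closed[OF N] unfolding lessThan_Suc by (intro ST.finsum_insert) auto
    also have "(\<Oplus>\<^bsub>ST N\<^esub>i\<in>{..<k}. SP N (a' i) (n' i)) = Y"
      unfolding Y using a n S_pure_closed[OF N]
      by (intro ST.finsum_cong') (auto simp: a'_def n'_def)
    finally have "SP N c m \<oplus>\<^bsub>ST N\<^esub> Y = (\<Oplus>\<^bsub>ST N\<^esub>i\<in>{..<Suc k}. SP N (a' i) (n' i))"
      by (simp add: a'_def n'_def)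
    with a' n' show ?case by blast
  qed
  then show thesis using that by blast
qed

text \<open>
An element of \<open>S \<otimes>\<^sub>R N\<close> is the sum of a finite list of pure tensors, and over an infinite
type there are no more finite lists of pairs than elements. Thus an infinite universe that contains
\<open>S\<close> and \<open>N\<close> also contains a copy of \<open>S \<otimes>\<^sub>R N\<close>.
\<close>

lemma S_tensor_lepoll:
  assumes N: "left_module S N" and inf: "infinite (UNIV :: 'u set)"
    and S_small: "carrier S \<lesssim> (UNIV :: 'u set)" and N_small: "carrier N \<lesssim> (UNIV :: 'u set)"
  shows "carrier (ST N) \<lesssim> (UNIV :: 'u set)"
proof -
  interpret ST: left_module S "ST N" by (rule S_tensor_module[OF N])
  define total where
    "total xs = (\<Oplus>\<^bsub>ST N\<^esub>i\<in>{..<length xs}. SP N (fst (xs ! i)) (snd (xs ! i)))" for xs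
  have "carrier (ST N) \<subseteq> total ` lists (carrier S \<times> carrier N)"
  proof
    fix X assume "X \<in> carrier (ST N)"
    then obtain k :: nat and a n where an: "a \<in> {..<k} \<rightarrow> carrier S" "n \<in> {..<k} \<rightarrow> carrier N"
      and X: "X = (\<Oplus>\<^bsub>ST N\<^esub>i\<in>{..<k}. SP N (a i) (n i))"
      by (rule S_tensor_finite_sum[OF N])
    define xs where "xs = map (\<lambda>i. (a i, n i)) [0..<k]"
    have "total xs = X"
      unfolding total_def X using an S_pure_closed[OF N]
      by (intro ST.finsum_cong') (auto simp: xs_def)
    moreover have "xs \<in> lists (carrier S \<times> carrier N)"
      using an by (auto simp: xs_def Pi_iff)
    ultimately show "X \<in> total ` lists (carrier S \<times> carrier N)" by blast
  qed
  then have "carrier (ST N) \<lesssim> lists (carrier S \<times> carrier N)"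
    by (meson image_lepoll lepoll_trans subset_imp_lepoll)
  also have "\<dots> \<lesssim> lists (UNIV :: ('u \<times> 'u) set)"
    using times_lepoll_mono[OF S_small N_small] by (intro lists_lepoll_mono) simp
  also have "\<dots> \<lesssim> lists (UNIV :: 'u set)"
    using card_of_Times_same_infinite[OF inf]
    by (intro lists_lepoll_mono eqpoll_imp_lepoll) (simp add: eqpoll_iff_card_of_ordIso)
  also have "\<dots> \<lesssim> (UNIV :: 'u set)"
    using card_of_lists_infinite[OF inf]
    by (intro eqpoll_imp_lepoll) (simp add: eqpoll_iff_card_of_ordIso)
  finally show ?thesis .
qed

lemma S_tensor_sum_map:
  assumes N: "left_module S N" and L: "abelian_group L" and h: "additive_map (ST N) L h"
    and "a \<in> I \<rightarrow> carrier S" "n \<in> I \<rightarrow> carrier N"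
  shows "h (\<Oplus>\<^bsub>ST N\<^esub>i\<in>I. SP N (a i) (n i)) = (\<Oplus>\<^bsub>L\<^esub>i\<in>I. h (SP N (a i) (n i)))"
proof -
  interpret ST: left_module S "ST N" by (rule S_tensor_module[OF N])
  show ?thesis
    using assms(4,5) S_pure_closed[OF N]
    by (intro additive_map_finsum[OF ST.abelian_group_axioms L h]) auto
qed

end

section \<open>h-separability as a multiplicative retraction\<close>

lemma module_cat_simps [simp]:
  "Obj (module_cat R) = {M. left_module R M}" "Hom (module_cat R) = lin_maps R"
  "Comp (module_cat R) X Y Z g f = compose (carrier X) g f"
  "Ident (module_cat R) X = (\<lambda>x\<in>carrier X. x)"
  by (simp_all add: module_cat_def)

lemma lin_maps_id: "left_module R M \<Longrightarrow> (\<lambda>x\<in>carrier M. x) \<in> lin_maps R M M"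
proof -
  assume "left_module R M"
  then interpret M: left_module R M .
  show ?thesis by (rule lin_mapsI) (simp_all add: M.smult_closed)
qed

lemma category_module_cat:
  fixes R :: "('r, 'x) ring_scheme"
  shows "category (module_cat R :: (('r, 'm) module, 'm \<Rightarrow> 'm) cat)"
proof (unfold_locales, unfold module_cat_simps mem_Collect_eq)
  fix W X Y Z :: "('r, 'm) module" and f g h
  assume "f \<in> lin_maps R W X" "g \<in> lin_maps R X Y" "h \<in> lin_maps R Y Z"
  then show "compose (carrier W) h (compose (carrier W) g f)
    = compose (carrier W) (compose (carrier X) h g) f"
    by (auto simp: compose_def fun_eq_iff lin_maps_closed)
next
  fix X Y :: "('r, 'm) module" and f assume f: "f \<in> lin_maps R X Y"
  show "compose (carrier X) (\<lambda>x\<in>carrier Y. x) f = f"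
    using lin_maps_extensional[OF f] lin_maps_closed[OF f]
    by (auto simp: compose_def fun_eq_iff extensional_def)
  show "compose (carrier X) f (\<lambda>x\<in>carrier X. x) = f"
    using lin_maps_extensional[OF f] by (auto simp: compose_def fun_eq_iff extensional_def)
qed (auto intro: lin_maps_compose lin_maps_id)

text \<open>
Naturality follows from these laws: if \<open>u\<close> and \<open>v\<close> are \<open>S\<close>-linear, then
\<open>P(v f u) = P(v) P(f) P(u) = v P(f) u\<close>. The laws thus amount to h-separability of restriction of
scalars.
\<close>

locale retraction = ring_extension R S \<phi>
  for R :: "('r, 'x) ring_scheme" and S :: "('s, 'y) ring_scheme" and \<phi> :: "'r \<Rightarrow> 's" +
  fixes P :: "('s, 'u) module \<Rightarrow> ('s, 'u) module \<Rightarrow> ('u \<Rightarrow> 'u) \<Rightarrow> 'u \<Rightarrow> 'u"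
  assumes P_lin: "\<lbrakk>left_module S X; left_module S Y;
      f \<in> lin_maps R (restrict_scalars \<phi> X) (restrict_scalars \<phi> Y)\<rbrakk>
      \<Longrightarrow> P X Y f \<in> lin_maps S X Y"
    and P_retracts: "\<lbrakk>left_module S X; left_module S Y; f \<in> lin_maps S X Y\<rbrakk> \<Longrightarrow> P X Y f = f"
    and P_compose: "\<lbrakk>left_module S X; left_module S Y; left_module S Z;
      g \<in> lin_maps R (restrict_scalars \<phi> X) (restrict_scalars \<phi> Y);
      f \<in> lin_maps R (restrict_scalars \<phi> Y) (restrict_scalars \<phi> Z)\<rbrakk>
      \<Longrightarrow> P X Z (compose (carrier X) f g) = compose (carrier X) (P Y Z f) (P X Y g)"

context ring_extension begin

lemma S_lin_maps_restrict:
  "f \<in> lin_maps S M N \<Longrightarrow> f \<in> lin_maps R (restrict_scalars \<phi> M) (restrict_scalars \<phi> N)"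
  by (auto simp: lin_maps_def)

lemma cat_functor_restrict_scalars:
  "cat_functor (module_cat S) (module_cat R) (restrict_scalars \<phi>) (\<lambda>X Y f. f)"
  by (intro cat_functor.intro cat_functor_axioms.intro category_module_cat)
    (simp_all add: restrict_scalars_module S_lin_maps_restrict)

lemma h_separable_extension_iff_retraction:
  "h_separable_extension TYPE('u) R S \<phi> \<longleftrightarrow>
    (\<exists>P :: ('s, 'u) module \<Rightarrow> ('s, 'u) module \<Rightarrow> ('u \<Rightarrow> 'u) \<Rightarrow> 'u \<Rightarrow> 'u. retraction R S \<phi> P)"
proof
  assume "h_separable_extension TYPE('u) R S \<phi>"
  then obtain P :: "('s, 'u) module \<Rightarrow> ('s, 'u) module \<Rightarrow> ('u \<Rightarrow> 'u) \<Rightarrow> 'u \<Rightarrow> 'u"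
    where "\<forall>X\<in>{M. left_module S M}. \<forall>Y\<in>{M. left_module S M}.
        P X Y \<in> lin_maps R (restrict_scalars \<phi> X) (restrict_scalars \<phi> Y) \<rightarrow> lin_maps S X Y"
      and "\<forall>X\<in>{M. left_module S M}. \<forall>Y\<in>{M. left_module S M}. \<forall>f\<in>lin_maps S X Y. P X Y f = f"
      and "\<forall>X\<in>{M. left_module S M}. \<forall>Y\<in>{M. left_module S M}. \<forall>Z\<in>{M. left_module S M}.
        \<forall>g\<in>lin_maps R (restrict_scalars \<phi> X) (restrict_scalars \<phi> Y).
        \<forall>f\<in>lin_maps R (restrict_scalars \<phi> Y) (restrict_scalars \<phi> Z).
          P X Z (compose (carrier X) f g) = compose (carrier X) (P Y Z f) (P X Y g)"
    unfolding h_separable_extension_def h_separable_functor_def module_cat_simps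
      restrict_scalars_simps by (elim conjE exE) blast
  then have "retraction R S \<phi> P"
    by (intro retraction.intro ring_extension_axioms retraction_axioms.intro) blast+
  then show "\<exists>P :: ('s, 'u) module \<Rightarrow> ('s, 'u) module \<Rightarrow> ('u \<Rightarrow> 'u) \<Rightarrow> 'u \<Rightarrow> 'u.
      retraction R S \<phi> P" by blast
next
  assume "\<exists>P :: ('s, 'u) module \<Rightarrow> ('s, 'u) module \<Rightarrow> ('u \<Rightarrow> 'u) \<Rightarrow> 'u \<Rightarrow> 'u. retraction R S \<phi> P"
  then obtain P :: "('s, 'u) module \<Rightarrow> ('s, 'u) module \<Rightarrow> ('u \<Rightarrow> 'u) \<Rightarrow> 'u \<Rightarrow> 'u"
    where "retraction R S \<phi> P" by blast
  then interpret retraction R S \<phi> P .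
  have "P X' Y' (compose (carrier X') v (compose (carrier X') f u))
      = compose (carrier X') v (compose (carrier X') (P X Y f) u)"
    if "left_module S X" "left_module S Y" "left_module S X'" "left_module S Y'"
      "u \<in> lin_maps S X' X" "v \<in> lin_maps S Y Y'"
      "f \<in> lin_maps R (restrict_scalars \<phi> X) (restrict_scalars \<phi> Y)" for X Y X' Y' u v f
  proof -
    have "compose (carrier X') f u \<in> lin_maps R (restrict_scalars \<phi> X') (restrict_scalars \<phi> Y)"
      using lin_maps_compose[OF restrict_scalars_module S_lin_maps_restrict] that by fastforce
    then show ?thesis
      using that by (simp add: P_compose[of X' Y Y'] P_compose[of X' X Y] P_retracts
          S_lin_maps_restrict)
  qed
  then show "h_separable_extension TYPE('u) R S \<phi>"
    unfolding h_separable_extension_def h_separable_functor_def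
    by (intro conjI cat_functor_restrict_scalars exI[of _ P])
      (simp_all add: P_lin P_retracts P_compose)
qed

end

section \<open>From an idempotent to a retraction\<close>

context ring_extension begin

text \<open>
For a fixed \<open>x\<close>, the expression \<open>a f(b x)\<close> is balanced in \<open>a\<close> and \<open>b\<close>, precisely
because \<open>f\<close> is \<open>R\<close>-linear. Identities between sums of such expressions thus follow from
identities in \<open>S \<otimes>\<^sub>R S\<close>.
\<close>

lemma sandwich_lift:
  assumes X: "left_module S X" and Y: "left_module S Y"
    and f: "f \<in> lin_maps R (restrict_scalars \<phi> X) (restrict_scalars \<phi> Y)"
    and x: "x \<in> carrier X"
  obtains h where "h \<in> lin_maps S (SS R S \<phi>) Y"
    and "\<And>a b. \<lbrakk>a \<in> carrier S; b \<in> carrier S\<rbrakk>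
      \<Longrightarrow> h (pure2 R S \<phi> a b) = a \<odot>\<^bsub>Y\<^esub> f (b \<odot>\<^bsub>X\<^esub> x)"
proof -
  interpret X: left_module S X by (rule X)
  interpret Y: left_module S Y by (rule Y)
  note f_simps = lin_maps_closed[OF f, simplified] lin_maps_add[OF f, simplified]
    lin_maps_smult[OF f, simplified]
  show thesis
    by (rule S_tensor_lift[OF left_regular_module Y, of "\<lambda>a b. a \<odot>\<^bsub>Y\<^esub> f (b \<odot>\<^bsub>X\<^esub> x)"])
      (use that x in \<open>simp_all add: X.smult_closed Y.smult_closed X.smult_l_distr Y.smult_l_distr
        Y.smult_r_distr X.smult_assoc Y.smult_assoc f_simps\<close>)
qed

definition sandwich ::
  "nat \<Rightarrow> (nat \<Rightarrow> 's) \<Rightarrow> (nat \<Rightarrow> 's) \<Rightarrow> ('s, 'm) module \<Rightarrow> ('s, 'n) module \<Rightarrow> ('m \<Rightarrow> 'n) \<Rightarrow> 'm \<Rightarrow> 'n"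
  where "sandwich n a b X Y f =
    (\<lambda>x\<in>carrier X. \<Oplus>\<^bsub>Y\<^esub>i\<in>{..<n}. a i \<odot>\<^bsub>Y\<^esub> f (b i \<odot>\<^bsub>X\<^esub> x))"

text \<open>
With \<open>e = \<Sum> a\<^sub>i \<otimes> b\<^sub>i\<close>, put \<open>P(f)(x) = \<Sum> a\<^sub>i f(b\<^sub>i x)\<close>. Centrality of
\<open>e\<close> makes \<open>P(f)\<close> linear over \<open>S\<close>; \<open>\<Sum> a\<^sub>i b\<^sub>i = 1\<close> gives \<open>P(f) = f\<close> for
\<open>S\<close>-linear \<open>f\<close>; and applying \<open>a \<otimes> b \<otimes> c \<mapsto> a f(b g(c x))\<close> to the two sides of
the identity in \<open>S \<otimes>\<^sub>R S \<otimes>\<^sub>R S\<close> gives \<open>P(f)(P(g)(x))\<close> and \<open>P(f g)(x)\<close>.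
\<close>

lemma retraction_of_idempotent:
  assumes e: "h_separability_idempotent R S \<phi> e"
  shows "\<exists>P :: ('s, 'u) module \<Rightarrow> ('s, 'u) module \<Rightarrow> ('u \<Rightarrow> 'u) \<Rightarrow> 'u \<Rightarrow> 'u. retraction R S \<phi> P"
proof -
  obtain n :: nat and a b where a: "a \<in> {..<n} \<rightarrow> carrier S" and b: "b \<in> {..<n} \<rightarrow> carrier S"
    and unit: "(\<Oplus>\<^bsub>S\<^esub>i\<in>{..<n}. a i \<otimes>\<^bsub>S\<^esub> b i) = \<one>\<^bsub>S\<^esub>"
    and central: "\<And>s. s \<in> carrier S \<Longrightarrow>
        (\<Oplus>\<^bsub>SS R S \<phi>\<^esub>i\<in>{..<n}. pure2 R S \<phi> (s \<otimes>\<^bsub>S\<^esub> a i) (b i))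
        = (\<Oplus>\<^bsub>SS R S \<phi>\<^esub>i\<in>{..<n}. pure2 R S \<phi> (a i) (b i \<otimes>\<^bsub>S\<^esub> s))"
    and heavy: "(\<Oplus>\<^bsub>SSS R S \<phi>\<^esub>i\<in>{..<n}. \<Oplus>\<^bsub>SSS R S \<phi>\<^esub>j\<in>{..<n}.
         pure3 R S \<phi> (a i) (b i \<otimes>\<^bsub>S\<^esub> a j) (b j))
      = (\<Oplus>\<^bsub>SSS R S \<phi>\<^esub>i\<in>{..<n}. pure3 R S \<phi> (a i) \<one>\<^bsub>S\<^esub> (b i))"
    using e unfolding h_separability_idempotent_def by (elim exE conjE) blast
  have a_closed: "\<And>i. i < n \<Longrightarrow> a i \<in> carrier S" and b_closed: "\<And>i. i < n \<Longrightarrow> b i \<in> carrier S"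
    using a b by auto
  note SSmod = S_tensor_module[OF left_regular_module]
  note SSSmod = S_tensor_module[OF SSmod]
  interpret SS: left_module S "SS R S \<phi>" by (rule SSmod)
  interpret SSS: left_module S "SSS R S \<phi>" by (rule SSSmod)
  note pure2_closed = S_pure_closed[OF left_regular_module, simplified]
  note pure3_closed = S_pure_closed[OF SSmod]

  have term_closed: "a i \<odot>\<^bsub>Y\<^esub> f (b i \<odot>\<^bsub>X\<^esub> x) \<in> carrier Y"
    if "left_module S X" "left_module S Y"
      "f \<in> lin_maps R (restrict_scalars \<phi> X) (restrict_scalars \<phi> Y)" "x \<in> carrier X" "i < n"
    for X Y :: "('s, 'u) module" and f x i
  proof -
    interpret X: left_module S X by fact
    interpret Y: left_module S Y by fact
    show ?thesis
      using that lin_maps_closed[OF that(3), simplified] a_closed b_closed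
      by (simp add: X.smult_closed Y.smult_closed)
  qed

  have lin: "sandwich n a b X Y f \<in> lin_maps S X Y"
    if X: "left_module S X" and Y: "left_module S Y"
      and f: "f \<in> lin_maps R (restrict_scalars \<phi> X) (restrict_scalars \<phi> Y)"
    for X Y :: "('s, 'u) module" and f
  proof (rule lin_mapsI)
    interpret X: left_module S X by (rule X)
    interpret Y: left_module S Y by (rule Y)
    note f_simps = lin_maps_closed[OF f, simplified] lin_maps_add[OF f, simplified]
    show "sandwich n a b X Y f x \<in> carrier Y" if "x \<in> carrier X" for x
      using that by (auto simp: sandwich_def term_closed[OF X Y f] intro!: Y.finsum_closed)
    show "sandwich n a b X Y f (x \<oplus>\<^bsub>X\<^esub> y) = sandwich n a b X Y f x \<oplus>\<^bsub>Y\<^esub> sandwich n a b X Y f y"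
      if "x \<in> carrier X" "y \<in> carrier X" for x y
    proof -
      have "(\<Oplus>\<^bsub>Y\<^esub>i\<in>{..<n}. a i \<odot>\<^bsub>Y\<^esub> f (b i \<odot>\<^bsub>X\<^esub> (x \<oplus>\<^bsub>X\<^esub> y)))
          = (\<Oplus>\<^bsub>Y\<^esub>i\<in>{..<n}. a i \<odot>\<^bsub>Y\<^esub> f (b i \<odot>\<^bsub>X\<^esub> x) \<oplus>\<^bsub>Y\<^esub> a i \<odot>\<^bsub>Y\<^esub> f (b i \<odot>\<^bsub>X\<^esub> y))"
        using that a_closed b_closed
        by (intro Y.finsum_cong') (auto simp: X.smult_r_distr Y.smult_r_distr f_simps
            X.smult_closed Y.smult_closed)
      also have "\<dots> = (\<Oplus>\<^bsub>Y\<^esub>i\<in>{..<n}. a i \<odot>\<^bsub>Y\<^esub> f (b i \<odot>\<^bsub>X\<^esub> x))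
          \<oplus>\<^bsub>Y\<^esub> (\<Oplus>\<^bsub>Y\<^esub>i\<in>{..<n}. a i \<odot>\<^bsub>Y\<^esub> f (b i \<odot>\<^bsub>X\<^esub> y))"
        using that term_closed[OF X Y f] by (intro Y.finsum_addf) auto
      finally show ?thesis
        using that by (simp add: sandwich_def)
    qed
    show "sandwich n a b X Y f (s \<odot>\<^bsub>X\<^esub> x) = s \<odot>\<^bsub>Y\<^esub> sandwich n a b X Y f x"
      if s: "s \<in> carrier S" and x: "x \<in> carrier X" for s x
    proof -
      obtain h where h: "h \<in> lin_maps S (SS R S \<phi>) Y"
        and h_pure: "\<And>a b. \<lbrakk>a \<in> carrier S; b \<in> carrier S\<rbrakk>
          \<Longrightarrow> h (pure2 R S \<phi> a b) = a \<odot>\<^bsub>Y\<^esub> f (b \<odot>\<^bsub>X\<^esub> x)"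
        by (rule sandwich_lift[OF X Y f x]) blast
      note h_sum = S_tensor_sum_map[OF left_regular_module Y.abelian_group_axioms
          lin_maps_additive[OF h]]
      have "sandwich n a b X Y f (s \<odot>\<^bsub>X\<^esub> x)
          = (\<Oplus>\<^bsub>Y\<^esub>i\<in>{..<n}. h (pure2 R S \<phi> (a i) (b i \<otimes>\<^bsub>S\<^esub> s)))"
        using s x a_closed b_closed term_closed[OF X Y f, of "s \<odot>\<^bsub>X\<^esub> x"]
        by (auto simp: sandwich_def X.smult_closed h_pure X.smult_assoc Pi_iff
            intro!: Y.finsum_cong')
      also have "\<dots> = h (\<Oplus>\<^bsub>SS R S \<phi>\<^esub>i\<in>{..<n}. pure2 R S \<phi> (s \<otimes>\<^bsub>S\<^esub> a i) (b i))"
        unfolding central[OF s] using s a_closed b_closed by (intro h_sum[symmetric]) auto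
      also have "\<dots> = (\<Oplus>\<^bsub>Y\<^esub>i\<in>{..<n}. h (pure2 R S \<phi> (s \<otimes>\<^bsub>S\<^esub> a i) (b i)))"
        using s a_closed b_closed by (intro h_sum) auto
      also have "\<dots> = (\<Oplus>\<^bsub>Y\<^esub>i\<in>{..<n}. s \<odot>\<^bsub>Y\<^esub> (a i \<odot>\<^bsub>Y\<^esub> f (b i \<odot>\<^bsub>X\<^esub> x)))"
        using s x a_closed b_closed term_closed[OF X Y f]
        by (intro Y.finsum_cong') (auto simp: h_pure Y.smult_assoc Y.smult_closed f_simps
            X.smult_closed)
      also have "\<dots> = s \<odot>\<^bsub>Y\<^esub> (\<Oplus>\<^bsub>Y\<^esub>i\<in>{..<n}. a i \<odot>\<^bsub>Y\<^esub> f (b i \<odot>\<^bsub>X\<^esub> x))"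
        using s x term_closed[OF X Y f]
        by (intro additive_map_finsum[of Y Y "\<lambda>y. s \<odot>\<^bsub>Y\<^esub> y", symmetric] Y.abelian_group_axioms
            additive_mapI) (auto simp: Y.smult_closed Y.smult_r_distr)
      finally show ?thesis
        using x by (simp add: sandwich_def)
    qed
  qed (simp add: sandwich_def)

  have retracts: "sandwich n a b X Y f = f"
    if X: "left_module S X" and Y: "left_module S Y" and f: "f \<in> lin_maps S X Y"
    for X Y :: "('s, 'u) module" and f
  proof (rule lin_maps_ext[OF lin[OF X Y S_lin_maps_restrict[OF f]] f])
    interpret X: left_module S X by (rule X)
    interpret Y: left_module S Y by (rule Y)
    fix x assume x: "x \<in> carrier X"
    note f_closed = lin_maps_closed[OF f]
    have "sandwich n a b X Y f x = (\<Oplus>\<^bsub>Y\<^esub>i\<in>{..<n}. (a i \<otimes>\<^bsub>S\<^esub> b i) \<odot>\<^bsub>Y\<^esub> f x)"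
      using x a_closed b_closed f_closed
      by (auto simp: sandwich_def lin_maps_smult[OF f] Y.smult_assoc Y.smult_closed
          intro!: Y.finsum_cong')
    also have "\<dots> = (\<Oplus>\<^bsub>S\<^esub>i\<in>{..<n}. a i \<otimes>\<^bsub>S\<^esub> b i) \<odot>\<^bsub>Y\<^esub> f x"
      using x a_closed b_closed f_closed
      by (intro additive_map_finsum[of S Y "\<lambda>s. s \<odot>\<^bsub>Y\<^esub> f x", symmetric] Y.abelian_group_axioms
            S.abelian_group_axioms additive_mapI) (auto simp: Y.smult_closed Y.smult_l_distr)
    finally show "sandwich n a b X Y f x = f x"
      using x f_closed by (simp add: unit Y.smult_one)
  qed

  have compose: "sandwich n a b X Z (compose (carrier X) f g)
      = compose (carrier X) (sandwich n a b Y Z f) (sandwich n a b X Y g)"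
    if X: "left_module S X" and Y: "left_module S Y" and Z: "left_module S Z"
      and g: "g \<in> lin_maps R (restrict_scalars \<phi> X) (restrict_scalars \<phi> Y)"
      and f: "f \<in> lin_maps R (restrict_scalars \<phi> Y) (restrict_scalars \<phi> Z)"
    for X Y Z :: "('s, 'u) module" and f g
  proof -
    interpret X: left_module S X by (rule X)
    interpret Y: left_module S Y by (rule Y)
    interpret Z: left_module S Z by (rule Z)
    note g_closed = lin_maps_closed[OF g, simplified]
    note f_simps = lin_maps_closed[OF f, simplified] lin_maps_add[OF f, simplified]
      lin_maps_smult[OF f, simplified]
    have fg: "compose (carrier X) f g
        \<in> lin_maps R (restrict_scalars \<phi> X) (restrict_scalars \<phi> Z)"
      using lin_maps_compose[OF restrict_scalars_module[OF X] g f] by simp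
    show ?thesis
    proof (rule lin_maps_ext[OF lin[OF X Z fg] lin_maps_compose[OF X lin[OF X Y g] lin[OF Y Z f]]])
      fix x assume x: "x \<in> carrier X"
      obtain h where h: "h \<in> lin_maps S (SS R S \<phi>) Y"
        and h_pure: "\<And>a b. \<lbrakk>a \<in> carrier S; b \<in> carrier S\<rbrakk>
          \<Longrightarrow> h (pure2 R S \<phi> a b) = a \<odot>\<^bsub>Y\<^esub> g (b \<odot>\<^bsub>X\<^esub> x)"
        by (rule sandwich_lift[OF X Y g x]) blast
      note h_simps = lin_maps_closed[OF h] lin_maps_add[OF h] lin_maps_smult[OF h]
      \<comment> \<open>The map of the triple tensor product that sends \<open>a \<otimes> b \<otimes> c\<close> to \<open>a f(b g(c x))\<close>.
        It descends to the outer tensor product because \<open>h\<close> is linear over \<open>S\<close>, hence over \<open>R\<close>.\<close>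
      obtain H where H: "H \<in> lin_maps S (SSS R S \<phi>) Z"
        and H_pure: "\<And>c t. \<lbrakk>c \<in> carrier S; t \<in> carrier (SS R S \<phi>)\<rbrakk>
          \<Longrightarrow> H (SP (SS R S \<phi>) c t) = c \<odot>\<^bsub>Z\<^esub> f (h t)"
        by (rule S_tensor_lift[OF SSmod Z, of "\<lambda>c t. c \<odot>\<^bsub>Z\<^esub> f (h t)"])
          (simp_all add: Z.smult_closed Z.smult_l_distr Z.smult_r_distr Z.smult_assoc f_simps
            h_simps)
      note H_sum = S_tensor_sum_map[OF SSmod Z.abelian_group_axioms lin_maps_additive[OF H]]
      have H_pure3: "H (pure3 R S \<phi> c d c') = c \<odot>\<^bsub>Z\<^esub> f (d \<odot>\<^bsub>Y\<^esub> g (c' \<odot>\<^bsub>X\<^esub> x))"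
        if "c \<in> carrier S" "d \<in> carrier S" "c' \<in> carrier S" for c d c'
        using that by (simp add: H_pure h_pure pure2_closed)
      have pure3_closed': "pure3 R S \<phi> c d c' \<in> carrier (SSS R S \<phi>)"
        if "c \<in> carrier S" "d \<in> carrier S" "c' \<in> carrier S" for c d c'
        using that by (simp add: pure2_closed pure3_closed)
      have "sandwich n a b X Z (compose (carrier X) f g) x
          = (\<Oplus>\<^bsub>Z\<^esub>i\<in>{..<n}. H (pure3 R S \<phi> (a i) \<one>\<^bsub>S\<^esub> (b i)))"
        using x a_closed b_closed
        by (auto simp: sandwich_def compose_def H_pure3 X.smult_closed Y.smult_one g_closed
            f_simps Z.smult_closed intro!: Z.finsum_cong')
      also have "\<dots> = H (\<Oplus>\<^bsub>SSS R S \<phi>\<^esub>i\<in>{..<n}. \<Oplus>\<^bsub>SSS R S \<phi>\<^esub>j\<in>{..<n}.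
         pure3 R S \<phi> (a i) (b i \<otimes>\<^bsub>S\<^esub> a j) (b j))"
        unfolding heavy using a_closed b_closed
        by (intro H_sum[symmetric]) (auto simp: pure2_closed)
      also have "\<dots> = (\<Oplus>\<^bsub>Z\<^esub>i\<in>{..<n}. H (\<Oplus>\<^bsub>SSS R S \<phi>\<^esub>j\<in>{..<n}.
         pure3 R S \<phi> (a i) (b i \<otimes>\<^bsub>S\<^esub> a j) (b j)))"
        using a_closed b_closed
        by (intro additive_map_finsum[OF SSS.abelian_group_axioms Z.abelian_group_axioms
              lin_maps_additive[OF H]]) (auto intro!: SSS.finsum_closed pure3_closed')
      also have "\<dots> = (\<Oplus>\<^bsub>Z\<^esub>i\<in>{..<n}. a i \<odot>\<^bsub>Z\<^esub> f (b i \<odot>\<^bsub>Y\<^esub> sandwich n a b X Y g x))"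
      proof (rule Z.finsum_cong')
        fix i assume "i \<in> {..<n}"
        then have ab: "a i \<in> carrier S" "b i \<in> carrier S"
          using a_closed b_closed by auto
        have t: "a j \<odot>\<^bsub>Y\<^esub> g (b j \<odot>\<^bsub>X\<^esub> x) \<in> carrier Y" if "j \<in> {..<n}" for j
          using that x term_closed[OF X Y g] by simp
        define G where "G y = a i \<odot>\<^bsub>Z\<^esub> f (b i \<odot>\<^bsub>Y\<^esub> y)" for y
        have G: "additive_map Y Z G"
          using ab by (intro additive_mapI)
            (simp_all add: G_def Y.smult_closed Z.smult_closed Y.smult_r_distr Z.smult_r_distr
              f_simps)
        have "H (\<Oplus>\<^bsub>SSS R S \<phi>\<^esub>j\<in>{..<n}. pure3 R S \<phi> (a i) (b i \<otimes>\<^bsub>S\<^esub> a j) (b j))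
            = (\<Oplus>\<^bsub>Z\<^esub>j\<in>{..<n}. H (pure3 R S \<phi> (a i) (b i \<otimes>\<^bsub>S\<^esub> a j) (b j)))"
          using ab a_closed b_closed by (intro H_sum) (auto simp: pure2_closed)
        also have "\<dots> = (\<Oplus>\<^bsub>Z\<^esub>j\<in>{..<n}. G (a j \<odot>\<^bsub>Y\<^esub> g (b j \<odot>\<^bsub>X\<^esub> x)))"
          using ab x a_closed b_closed additive_map_closed[OF G t]
          by (intro Z.finsum_cong') (auto simp: H_pure3 G_def Y.smult_assoc X.smult_closed g_closed)
        also have "\<dots> = G (\<Oplus>\<^bsub>Y\<^esub>j\<in>{..<n}. a j \<odot>\<^bsub>Y\<^esub> g (b j \<odot>\<^bsub>X\<^esub> x))"
          using t by (intro additive_map_finsum[OF Y.abelian_group_axioms Z.abelian_group_axioms G,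
                symmetric]) auto
        finally show "H (\<Oplus>\<^bsub>SSS R S \<phi>\<^esub>j\<in>{..<n}. pure3 R S \<phi> (a i) (b i \<otimes>\<^bsub>S\<^esub> a j) (b j))
            = a i \<odot>\<^bsub>Z\<^esub> f (b i \<odot>\<^bsub>Y\<^esub> sandwich n a b X Y g x)"
          using x by (simp add: G_def sandwich_def)
      qed (use x term_closed[OF Y Z f] lin_maps_closed[OF lin[OF X Y g]] in auto)
      also have "\<dots> = compose (carrier X) (sandwich n a b Y Z f) (sandwich n a b X Y g) x"
        using x lin_maps_closed[OF lin[OF X Y g] x]
        by (simp add: compose_def sandwich_def[of n a b Y Z])
      finally show "sandwich n a b X Z (compose (carrier X) f g) x
        = compose (carrier X) (sandwich n a b Y Z f) (sandwich n a b X Y g) x" .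
    qed
  qed

  show ?thesis
    by (rule exI[of _ "sandwich n a b"], intro retraction.intro ring_extension_axioms
        retraction_axioms.intro lin retracts compose)
qed

end

section \<open>Copies of modules in the universe\<close>

text \<open>
The fields \<open>mult\<close> and \<open>one\<close> of the record carry no information about a module and are left
undefined. The definition is meant for \<open>j\<close> injective on the carrier, so that \<open>i\<close> inverts it.
\<close>

definition image_module :: "('m \<Rightarrow> 'u) \<Rightarrow> ('s, 'm) module \<Rightarrow> ('s, 'u) module" where
  "image_module j M = (let i = inv_into (carrier M) j in
    \<lparr>carrier = j ` carrier M, monoid.mult = undefined, one = undefined,
     ring.zero = j \<zero>\<^bsub>M\<^esub>, ring.add = (\<lambda>x y. j (i x \<oplus>\<^bsub>M\<^esub> i y)), smult = (\<lambda>s x. j (s \<odot>\<^bsub>M\<^esub> i x))\<rparr>)"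

lemma image_module_simps [simp]:
  "carrier (image_module j M) = j ` carrier M"
  "\<zero>\<^bsub>image_module j M\<^esub> = j \<zero>\<^bsub>M\<^esub>"
  "x \<oplus>\<^bsub>image_module j M\<^esub> y = j (inv_into (carrier M) j x \<oplus>\<^bsub>M\<^esub> inv_into (carrier M) j y)"
  "s \<odot>\<^bsub>image_module j M\<^esub> x = j (s \<odot>\<^bsub>M\<^esub> inv_into (carrier M) j x)"
  by (simp_all add: image_module_def Let_def)

lemma image_module_left_module:
  assumes "left_module S M" and j: "inj_on j (carrier M)"
  shows "left_module S (image_module j M)"
proof -
  interpret M: left_module S M by fact
  have "\<exists>y\<in>carrier (image_module j M). y \<oplus>\<^bsub>image_module j M\<^esub> x = \<zero>\<^bsub>image_module j M\<^esub>"
    if x: "x \<in> carrier (image_module j M)" for x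
  proof -
    obtain m where "m \<in> carrier M" "x = j m" using x by auto
    then show ?thesis
      by (intro bexI[of _ "j (\<ominus>\<^bsub>M\<^esub> m)"]) (simp_all add: j M.l_neg)
  qed
  then have "abelian_group (image_module j M)"
    by (intro abelian_groupI) (auto simp: j M.a_ac)
  then show ?thesis
    by (intro left_module.intro left_module_axioms.intro M.R.ring_axioms)
      (auto simp: j M.smult_closed M.smult_l_distr M.smult_r_distr M.smult_assoc M.smult_one)
qed

definition conj_map :: "('m \<Rightarrow> 'u) \<Rightarrow> ('n \<Rightarrow> 'v) \<Rightarrow> 'm set \<Rightarrow> ('m \<Rightarrow> 'n) \<Rightarrow> 'u \<Rightarrow> 'v" where
  "conj_map j k A f = (\<lambda>x\<in>j ` A. k (f (inv_into A j x)))"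

lemma conj_map_lin:
  assumes M: "left_module S M" and j: "inj_on j (carrier M)" and k: "inj_on k (carrier N)"
    and f: "f \<in> lin_maps S M N"
  shows "conj_map j k (carrier M) f \<in> lin_maps S (image_module j M) (image_module k N)"
proof -
  interpret M: left_module S M by fact
  show ?thesis
    by (rule lin_mapsI) (auto simp: conj_map_def j k inj_on_eq_iff[OF j] M.smult_closed
        lin_maps_closed[OF f] lin_maps_add[OF f] lin_maps_smult[OF f])
qed

context ring_extension begin

lemma restrict_image_module:
  "lin_maps R (restrict_scalars \<phi> (image_module j M)) (restrict_scalars \<phi> (image_module k N))
    = lin_maps R (image_module j (restrict_scalars \<phi> M)) (image_module k (restrict_scalars \<phi> N))"
  by (simp add: lin_maps_def)

end

context retraction begin

text \<open>
The given family \<open>P\<close> acts only on modules over the type \<open>'u\<close>, whereas \<open>S\<close> and its tensor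
powers live on other types. Transport applies \<open>P\<close> to copies of the modules inside \<open>'u\<close> and
moves the result back. The three lemmas that follow show that the laws of \<open>P\<close> survive, so that
afterwards \<open>P\<close> may be used as if it were defined on all sufficiently small modules.
\<close>

definition transport ::
  "('m \<Rightarrow> 'u) \<Rightarrow> ('n \<Rightarrow> 'u) \<Rightarrow> ('s, 'm) module \<Rightarrow> ('s, 'n) module \<Rightarrow> ('m \<Rightarrow> 'n) \<Rightarrow> 'm \<Rightarrow> 'n" where
  "transport j k M N f = (\<lambda>x\<in>carrier M. inv_into (carrier N) k
    (P (image_module j M) (image_module k N) (conj_map j k (carrier M) f) (j x)))"

lemma P_conj_map_lin:
  assumes M: "left_module S M" and N: "left_module S N"
    and j: "inj_on j (carrier M)" and k: "inj_on k (carrier N)"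
    and f: "f \<in> lin_maps R (restrict_scalars \<phi> M) (restrict_scalars \<phi> N)"
  shows "conj_map j k (carrier M) f
      \<in> lin_maps R (restrict_scalars \<phi> (image_module j M)) (restrict_scalars \<phi> (image_module k N))"
    and "P (image_module j M) (image_module k N) (conj_map j k (carrier M) f)
      \<in> lin_maps S (image_module j M) (image_module k N)"
proof -
  show "conj_map j k (carrier M) f
      \<in> lin_maps R (restrict_scalars \<phi> (image_module j M)) (restrict_scalars \<phi> (image_module k N))"
    using conj_map_lin[OF restrict_scalars_module[OF M], of j k "restrict_scalars \<phi> N" f] j k f
    by (simp add: restrict_image_module)
  then show "P (image_module j M) (image_module k N) (conj_map j k (carrier M) f)
      \<in> lin_maps S (image_module j M) (image_module k N)"
    by (intro P_lin image_module_left_module M N j k)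
qed

lemma transport_lin:
  assumes M: "left_module S M" and N: "left_module S N"
    and j: "inj_on j (carrier M)" and k: "inj_on k (carrier N)"
    and f: "f \<in> lin_maps R (restrict_scalars \<phi> M) (restrict_scalars \<phi> N)"
  shows "transport j k M N f \<in> lin_maps S M N"
proof -
  interpret M: left_module S M by fact
  interpret N: left_module S N by fact
  note q = P_conj_map_lin(2)[OF M N j k f]
  have closed: "inv_into (carrier N) k
      (P (image_module j M) (image_module k N) (conj_map j k (carrier M) f) (j x)) \<in> carrier N"
    if "x \<in> carrier M" for x
    using lin_maps_closed[OF q, of "j x"] that by (auto intro: inv_into_into)
  show ?thesis
  proof (rule lin_mapsI)
    fix x y assume "x \<in> carrier M" "y \<in> carrier M"
    then show "transport j k M N f (x \<oplus>\<^bsub>M\<^esub> y)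
        = transport j k M N f x \<oplus>\<^bsub>N\<^esub> transport j k M N f y"
      using lin_maps_add[OF q, of "j x" "j y"] by (simp add: transport_def j k closed)
  next
    fix s x assume "s \<in> carrier S" "x \<in> carrier M"
    then show "transport j k M N f (s \<odot>\<^bsub>M\<^esub> x) = s \<odot>\<^bsub>N\<^esub> transport j k M N f x"
      using lin_maps_smult[OF q, of s "j x"]
      by (simp add: transport_def j k closed M.smult_closed N.smult_closed)
  qed (simp_all add: transport_def closed)
qed

lemma transport_retracts:
  assumes M: "left_module S M" and N: "left_module S N"
    and j: "inj_on j (carrier M)" and k: "inj_on k (carrier N)" and f: "f \<in> lin_maps S M N"
  shows "transport j k M N f = f"
proof (rule lin_maps_ext[OF transport_lin[OF M N j k S_lin_maps_restrict[OF f]] f])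
  fix x assume "x \<in> carrier M"
  moreover have "P (image_module j M) (image_module k N) (conj_map j k (carrier M) f)
      = conj_map j k (carrier M) f"
    by (intro P_retracts image_module_left_module conj_map_lin M N j k f)
  ultimately show "transport j k M N f x = f x"
    by (simp add: transport_def conj_map_def j k lin_maps_closed[OF f])
qed

lemma transport_compose:
  assumes M: "left_module S M" and N: "left_module S N" and L: "left_module S L"
    and j: "inj_on j (carrier M)" and k: "inj_on k (carrier N)" and l: "inj_on l (carrier L)"
    and g: "g \<in> lin_maps R (restrict_scalars \<phi> M) (restrict_scalars \<phi> N)"
    and f: "f \<in> lin_maps R (restrict_scalars \<phi> N) (restrict_scalars \<phi> L)"
    and x: "x \<in> carrier M"
  shows "transport j l M L (compose (carrier M) f g) x
    = transport k l N L f (transport j k M N g x)"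
proof -
  have "conj_map j l (carrier M) (compose (carrier M) f g)
      = compose (carrier (image_module j M)) (conj_map k l (carrier N) f)
          (conj_map j k (carrier M) g)"
    using lin_maps_closed[OF g] by (auto simp: conj_map_def compose_def fun_eq_iff j k)
  moreover have "P (image_module j M) (image_module k N) (conj_map j k (carrier M) g) (j x)
      \<in> k ` carrier N"
    using lin_maps_closed[OF P_conj_map_lin(2)[OF M N j k g], of "j x"] x by simp
  ultimately show ?thesis
    using x P_compose[OF image_module_left_module[OF M j] image_module_left_module[OF N k]
        image_module_left_module[OF L l] P_conj_map_lin(1)[OF M N j k g]
        P_conj_map_lin(1)[OF N L k l f]]
    by (simp add: transport_def compose_def f_inv_into_f inv_into_into)
qed

section \<open>From a retraction to an idempotent\<close>

text \<open>
Write \<open>\<eta>(x) = 1 \<otimes> x\<close>, as a map from \<open>S\<close> to \<open>S \<otimes>\<^sub>R S\<close>, and let \<open>e = P(\<eta>)(1)\<close>.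
If \<open>h\<close> is an \<open>S\<close>-linear map out of \<open>S \<otimes>\<^sub>R S\<close>, then \<open>h(e) = P(h \<eta>)(1)\<close>,
so an identity for \<open>e\<close> follows from a factorization of \<open>h \<eta>\<close>.
\<close>

lemma idempotent_of_retraction:
  assumes inf: "infinite (UNIV :: 'u set)" and S_small: "carrier S \<lesssim> (UNIV :: 'u set)"
  shows "\<exists>e. h_separability_idempotent R S \<phi> e"
proof -
  let ?S = "left_regular S" and ?SS = "SS R S \<phi>" and ?SSS = "SSS R S \<phi>"
  note Smod = left_regular_module
  note SSmod = S_tensor_module[OF Smod]
  note SSSmod = S_tensor_module[OF SSmod]
  interpret SS: left_module S ?SS by (rule SSmod)
  interpret SSS: left_module S ?SSS by (rule SSSmod)
  have SS_small: "carrier ?SS \<lesssim> (UNIV :: 'u set)"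
    using S_tensor_lepoll[OF Smod inf S_small] S_small by simp
  have SSS_small: "carrier ?SSS \<lesssim> (UNIV :: 'u set)"
    by (rule S_tensor_lepoll[OF SSmod inf S_small SS_small])
  obtain j1 :: "'s \<Rightarrow> 'u" where j1: "inj_on j1 (carrier ?S)"
    using S_small by (auto simp: lepoll_def)
  obtain j2 :: "_ \<Rightarrow> 'u" where j2: "inj_on j2 (carrier ?SS)"
    using SS_small by (auto simp: lepoll_def)
  obtain j3 :: "_ \<Rightarrow> 'u" where j3: "inj_on j3 (carrier ?SSS)"
    using SSS_small by (auto simp: lepoll_def)
  define \<eta> where "\<eta> = (\<lambda>x\<in>carrier ?S. pure2 R S \<phi> \<one>\<^bsub>S\<^esub> x)"
  define \<eta>' where "\<eta>' = (\<lambda>t\<in>carrier ?SS. SP ?SS \<one>\<^bsub>S\<^esub> t)"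
  have \<eta>: "\<eta> \<in> lin_maps R (restrict_scalars \<phi> ?S) (restrict_scalars \<phi> ?SS)"
    unfolding \<eta>_def by (rule S_tensor_unit[OF Smod])
  have \<eta>': "\<eta>' \<in> lin_maps R (restrict_scalars \<phi> ?SS) (restrict_scalars \<phi> ?SSS)"
    unfolding \<eta>'_def by (rule S_tensor_unit[OF SSmod])
  define p where "p = transport j1 j2 ?S ?SS \<eta>"
  have p: "p \<in> lin_maps S ?S ?SS"
    unfolding p_def by (rule transport_lin[OF Smod SSmod j1 j2 \<eta>])
  define e where "e = p \<one>\<^bsub>S\<^esub>"
  have e_closed: "e \<in> carrier ?SS"
    using lin_maps_closed[OF p] by (simp add: e_def)
  note pure2_closed = S_pure_closed[OF Smod, simplified]

  obtain n :: nat and a b where a: "a \<in> {..<n} \<rightarrow> carrier S" and b: "b \<in> {..<n} \<rightarrow> carrier S"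
    and e_sum: "e = (\<Oplus>\<^bsub>?SS\<^esub>i\<in>{..<n}. pure2 R S \<phi> (a i) (b i))"
    by (rule S_tensor_finite_sum[OF Smod e_closed]) auto
  have a_closed: "\<And>i. i < n \<Longrightarrow> a i \<in> carrier S" and b_closed: "\<And>i. i < n \<Longrightarrow> b i \<in> carrier S"
    using a b by auto

  \<comment> \<open>The principle that all three properties of \<open>e\<close> are drawn from.\<close>
  have natural: "h e = transport j1 k ?S L (compose (carrier ?S) h \<eta>) \<one>\<^bsub>S\<^esub>"
    if L: "left_module S L" and k: "inj_on k (carrier L)" and h: "h \<in> lin_maps S ?SS L"
    for L :: "('s, 'l) module" and k h
    using transport_compose[OF Smod SSmod L j1 j2 k \<eta> S_lin_maps_restrict[OF h], of "\<one>\<^bsub>S\<^esub>"]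
      transport_retracts[OF SSmod L j2 k h]
    by (simp add: e_def p_def)

  have unit: "(\<Oplus>\<^bsub>S\<^esub>i\<in>{..<n}. a i \<otimes>\<^bsub>S\<^esub> b i) = \<one>\<^bsub>S\<^esub>"
  proof -
    \<comment> \<open>Multiplication satisfies \<open>m \<eta> = id\<close>, hence \<open>m(e) = 1\<close>.\<close>
    obtain m where m: "m \<in> lin_maps S ?SS ?S"
      and m_pure: "\<And>c d. \<lbrakk>c \<in> carrier S; d \<in> carrier S\<rbrakk> \<Longrightarrow> m (pure2 R S \<phi> c d) = c \<otimes>\<^bsub>S\<^esub> d"
      by (rule S_tensor_lift[OF Smod Smod, of "\<lambda>c d. c \<otimes>\<^bsub>S\<^esub> d"])
        (simp_all add: S.l_distr S.r_distr S.m_assoc)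
    have "compose (carrier ?S) m \<eta> = (\<lambda>x\<in>carrier ?S. x)"
      by (auto simp: compose_def fun_eq_iff \<eta>_def m_pure)
    then have "m e = \<one>\<^bsub>S\<^esub>"
      using natural[OF Smod j1 m] transport_retracts[OF Smod Smod j1 j1 lin_maps_id[OF Smod]]
      by simp
    moreover have "m e = (\<Oplus>\<^bsub>S\<^esub>i\<in>{..<n}. m (pure2 R S \<phi> (a i) (b i)))"
      unfolding e_sum using a_closed b_closed lin_maps_additive[OF m]
      by (intro S_tensor_sum_map[OF Smod S.abelian_group_axioms]) (auto simp: additive_map_def)
    moreover have "\<dots> = (\<Oplus>\<^bsub>S\<^esub>i\<in>{..<n}. a i \<otimes>\<^bsub>S\<^esub> b i)"
      using a_closed b_closed by (intro S.finsum_cong') (auto simp: m_pure)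
    ultimately show ?thesis by simp
  qed

  have smult_e: "s \<odot>\<^bsub>?SS\<^esub> e = (\<Oplus>\<^bsub>?SS\<^esub>i\<in>{..<n}. pure2 R S \<phi> (s \<otimes>\<^bsub>S\<^esub> a i) (b i))"
    if s: "s \<in> carrier S" for s
  proof -
    have "s \<odot>\<^bsub>?SS\<^esub> e = (\<Oplus>\<^bsub>?SS\<^esub>i\<in>{..<n}. s \<odot>\<^bsub>?SS\<^esub> pure2 R S \<phi> (a i) (b i))"
      unfolding e_sum using s a_closed b_closed
      by (intro S_tensor_sum_map[OF Smod SS.abelian_group_axioms] additive_mapI)
        (auto simp: SS.smult_closed SS.smult_r_distr)
    also have "\<dots> = (\<Oplus>\<^bsub>?SS\<^esub>i\<in>{..<n}. pure2 R S \<phi> (s \<otimes>\<^bsub>S\<^esub> a i) (b i))"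
      using s a_closed b_closed
      by (intro SS.finsum_cong') (auto simp: S_pure_smult[OF Smod] pure2_closed)
    finally show ?thesis .
  qed

  have tensor_e: "h e = (\<Oplus>\<^bsub>ST N\<^esub>i\<in>{..<n}. SP N (a i) (u (b i)))"
    if N: "left_module S N" and u: "u \<in> lin_maps S ?S N" and h: "h \<in> lin_maps S ?SS (ST N)"
      and h_pure: "\<And>c d. \<lbrakk>c \<in> carrier S; d \<in> carrier S\<rbrakk> \<Longrightarrow> h (pure2 R S \<phi> c d) = SP N c (u d)"
    for N :: "('s, 'n) module" and u h
  proof -
    interpret STN: left_module S "ST N" by (rule S_tensor_module[OF N])
    have "h e = (\<Oplus>\<^bsub>ST N\<^esub>i\<in>{..<n}. h (pure2 R S \<phi> (a i) (b i)))"
      unfolding e_sum using a_closed b_closed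
      by (intro S_tensor_sum_map[OF Smod STN.abelian_group_axioms lin_maps_additive[OF h]]) auto
    also have "\<dots> = (\<Oplus>\<^bsub>ST N\<^esub>i\<in>{..<n}. SP N (a i) (u (b i)))"
      using a_closed b_closed lin_maps_closed[OF u] S_pure_closed[OF N]
      by (intro STN.finsum_cong') (auto simp: h_pure)
    finally show ?thesis .
  qed

  have central: "(\<Oplus>\<^bsub>?SS\<^esub>i\<in>{..<n}. pure2 R S \<phi> (s \<otimes>\<^bsub>S\<^esub> a i) (b i))
      = (\<Oplus>\<^bsub>?SS\<^esub>i\<in>{..<n}. pure2 R S \<phi> (a i) (b i \<otimes>\<^bsub>S\<^esub> s))" if s: "s \<in> carrier S" for s
  proof -
    \<comment> \<open>Right multiplication by \<open>s\<close> gives \<open>(id \<otimes> \<rho>) \<eta> = \<eta> \<rho>\<close>, hence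
      \<open>e s = P(\<eta>)(\<rho>(1)) = P(\<eta>)(s) = s e\<close>.\<close>
    define \<rho> where "\<rho> = (\<lambda>x\<in>carrier ?S. x \<otimes>\<^bsub>S\<^esub> s)"
    have \<rho>: "\<rho> \<in> lin_maps S ?S ?S"
      unfolding \<rho>_def using s by (intro lin_mapsI) (simp_all add: S.l_distr S.m_assoc)
    obtain h where h: "h \<in> lin_maps S ?SS ?SS"
      and h_pure: "\<And>c d. \<lbrakk>c \<in> carrier S; d \<in> carrier S\<rbrakk>
        \<Longrightarrow> h (pure2 R S \<phi> c d) = pure2 R S \<phi> c (\<rho> d)"
      using S_tensor_map[OF Smod Smod \<rho>] by auto
    have "compose (carrier ?S) h \<eta> = compose (carrier ?S) \<eta> \<rho>"
      using lin_maps_closed[OF \<rho>] by (auto simp: compose_def fun_eq_iff \<eta>_def h_pure)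
    then have "h e = p (\<rho> \<one>\<^bsub>S\<^esub>)"
      using natural[OF SSmod j2 h]
        transport_compose[OF Smod Smod SSmod j1 j1 j2 S_lin_maps_restrict[OF \<rho>] \<eta>, of "\<one>\<^bsub>S\<^esub>"]
        transport_retracts[OF Smod Smod j1 j1 \<rho>]
      by (simp add: p_def)
    also have "\<dots> = s \<odot>\<^bsub>?SS\<^esub> e"
      using s lin_maps_smult[OF p, of s "\<one>\<^bsub>S\<^esub>"] by (simp add: \<rho>_def e_def)
    finally have "s \<odot>\<^bsub>?SS\<^esub> e = (\<Oplus>\<^bsub>?SS\<^esub>i\<in>{..<n}. pure2 R S \<phi> (a i) (\<rho> (b i)))"
      using tensor_e[OF Smod \<rho> h h_pure] by simp
    also have "\<dots> = (\<Oplus>\<^bsub>?SS\<^esub>i\<in>{..<n}. pure2 R S \<phi> (a i) (b i \<otimes>\<^bsub>S\<^esub> s))"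
      using s a_closed b_closed
      by (intro SS.finsum_cong') (auto simp: \<rho>_def pure2_closed)
    finally show ?thesis
      using smult_e[OF s] by simp
  qed

  have heavy: "(\<Oplus>\<^bsub>?SSS\<^esub>i\<in>{..<n}. \<Oplus>\<^bsub>?SSS\<^esub>j\<in>{..<n}.
         pure3 R S \<phi> (a i) (b i \<otimes>\<^bsub>S\<^esub> a j) (b j))
      = (\<Oplus>\<^bsub>?SSS\<^esub>i\<in>{..<n}. pure3 R S \<phi> (a i) \<one>\<^bsub>S\<^esub> (b i))"
  proof -
    \<comment> \<open>Let \<open>\<eta>'(t) = 1 \<otimes> t\<close> on \<open>S \<otimes>\<^sub>R S\<close>. The element \<open>P(\<eta>')(e)\<close> is computed in
      two ways. With \<open>\<kappa>(c \<otimes> d) = c \<otimes> 1 \<otimes> d\<close> one has \<open>\<kappa> \<eta> = \<eta>' \<eta>\<close>, and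
      \<open>P(\<eta>' \<eta>)(1) = P(\<eta>')(e)\<close> by multiplicativity. With \<open>\<mu>(x) = x e\<close> one has
      \<open>(id \<otimes> \<mu>) \<eta> = \<eta>' \<mu>\<close>, and \<open>P(\<eta>' \<mu>)(1) = P(\<eta>')(\<mu>(1)) = P(\<eta>')(e)\<close>.
      Therefore \<open>\<kappa>(e) = (id \<otimes> \<mu>)(e)\<close>.\<close>
    define \<mu> where "\<mu> = (\<lambda>x\<in>carrier ?S. x \<odot>\<^bsub>?SS\<^esub> e)"
    have \<mu>: "\<mu> \<in> lin_maps S ?S ?SS"
      unfolding \<mu>_def using e_closed
      by (intro lin_mapsI) (simp_all add: SS.smult_closed SS.smult_l_distr SS.smult_assoc)
    obtain h where h: "h \<in> lin_maps S ?SS ?SSS"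
      and h_pure: "\<And>c d. \<lbrakk>c \<in> carrier S; d \<in> carrier S\<rbrakk>
        \<Longrightarrow> h (pure2 R S \<phi> c d) = SP ?SS c (\<mu> d)"
      using S_tensor_map[OF Smod SSmod \<mu>] by auto
    have \<eta>R: "\<And>r d. \<lbrakk>r \<in> carrier R; d \<in> carrier S\<rbrakk>
        \<Longrightarrow> \<eta> (\<phi> r \<otimes>\<^bsub>S\<^esub> d) = \<phi> r \<odot>\<^bsub>?SS\<^esub> \<eta> d"
      using lin_maps_smult[OF \<eta>] by simp
    have \<eta>_closed: "\<And>d. d \<in> carrier S \<Longrightarrow> \<eta> d \<in> carrier ?SS"
      using lin_maps_closed[OF \<eta>] by simp
    have \<eta>_add: "\<And>d d'. \<lbrakk>d \<in> carrier S; d' \<in> carrier S\<rbrakk>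
        \<Longrightarrow> \<eta> (d \<oplus>\<^bsub>S\<^esub> d') = \<eta> d \<oplus>\<^bsub>?SS\<^esub> \<eta> d'"
      using lin_maps_add[OF \<eta>] by simp
    obtain \<kappa> where \<kappa>: "\<kappa> \<in> lin_maps S ?SS ?SSS"
      and \<kappa>_pure: "\<And>c d. \<lbrakk>c \<in> carrier S; d \<in> carrier S\<rbrakk>
        \<Longrightarrow> \<kappa> (pure2 R S \<phi> c d) = SP ?SS c (\<eta> d)"
      by (rule S_tensor_lift[OF Smod SSSmod, of "\<lambda>c d. SP ?SS c (\<eta> d)"])
        (simp_all add: S_pure_closed[OF SSmod] S_pure_add_left[OF SSmod] S_pure_add_right[OF SSmod]
          S_pure_smult[OF SSmod] S_pure_balanced[OF SSmod] \<eta>R \<eta>_closed \<eta>_add)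
    have "compose (carrier ?S) \<kappa> \<eta> = compose (carrier ?S) \<eta>' \<eta>"
      using \<eta>_closed by (auto simp: compose_def fun_eq_iff \<eta>_def \<eta>'_def \<kappa>_pure)
    then have \<kappa>_e: "\<kappa> e = transport j2 j3 ?SS ?SSS \<eta>' e"
      using natural[OF SSSmod j3 \<kappa>] transport_compose[OF Smod SSmod SSSmod j1 j2 j3 \<eta> \<eta>', of "\<one>\<^bsub>S\<^esub>"]
      by (simp add: e_def p_def)
    have "compose (carrier ?S) h \<eta> = compose (carrier ?S) \<eta>' \<mu>"
      using lin_maps_closed[OF \<mu>] by (auto simp: compose_def fun_eq_iff \<eta>_def \<eta>'_def h_pure)
    moreover have "\<mu> \<one>\<^bsub>S\<^esub> = e"
      using e_closed by (simp add: \<mu>_def SS.smult_one)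
    ultimately have "h e = \<kappa> e"
      using natural[OF SSSmod j3 h]
        transport_compose[OF Smod SSmod SSSmod j1 j2 j3 S_lin_maps_restrict[OF \<mu>] \<eta>', of "\<one>\<^bsub>S\<^esub>"]
        transport_retracts[OF Smod SSmod j1 j2 \<mu>] \<kappa>_e
      by simp
    moreover have "\<kappa> e = (\<Oplus>\<^bsub>?SSS\<^esub>i\<in>{..<n}. pure3 R S \<phi> (a i) \<one>\<^bsub>S\<^esub> (b i))"
    proof -
      have "\<kappa> e = (\<Oplus>\<^bsub>?SSS\<^esub>i\<in>{..<n}. \<kappa> (pure2 R S \<phi> (a i) (b i)))"
        unfolding e_sum using a_closed b_closed
        by (intro S_tensor_sum_map[OF Smod SSS.abelian_group_axioms lin_maps_additive[OF \<kappa>]]) auto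
      also have "\<dots> = (\<Oplus>\<^bsub>?SSS\<^esub>i\<in>{..<n}. pure3 R S \<phi> (a i) \<one>\<^bsub>S\<^esub> (b i))"
        using a_closed b_closed
        by (intro SSS.finsum_cong') (auto simp: \<kappa>_pure \<eta>_def pure2_closed S_pure_closed[OF SSmod])
      finally show ?thesis .
    qed
    moreover have "h e = (\<Oplus>\<^bsub>?SSS\<^esub>i\<in>{..<n}. \<Oplus>\<^bsub>?SSS\<^esub>j\<in>{..<n}.
         pure3 R S \<phi> (a i) (b i \<otimes>\<^bsub>S\<^esub> a j) (b j))"
    proof -
      have "h e = (\<Oplus>\<^bsub>?SSS\<^esub>i\<in>{..<n}. SP ?SS (a i) (\<mu> (b i)))"
        by (rule tensor_e[OF SSmod \<mu> h h_pure])
      also have "\<dots> = (\<Oplus>\<^bsub>?SSS\<^esub>i\<in>{..<n}. \<Oplus>\<^bsub>?SSS\<^esub>j\<in>{..<n}.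
         pure3 R S \<phi> (a i) (b i \<otimes>\<^bsub>S\<^esub> a j) (b j))"
      proof (rule SSS.finsum_cong')
        fix i assume "i \<in> {..<n}"
        then have ab: "a i \<in> carrier S" "b i \<in> carrier S"
          using a_closed b_closed by auto
        have "SP ?SS (a i) (\<mu> (b i))
            = SP ?SS (a i) (\<Oplus>\<^bsub>?SS\<^esub>j\<in>{..<n}. pure2 R S \<phi> (b i \<otimes>\<^bsub>S\<^esub> a j) (b j))"
          using ab by (simp add: \<mu>_def smult_e)
        also have "\<dots> = (\<Oplus>\<^bsub>?SSS\<^esub>j\<in>{..<n}. pure3 R S \<phi> (a i) (b i \<otimes>\<^bsub>S\<^esub> a j) (b j))"
          using ab a_closed b_closed
          by (intro S_tensor_sum_map[OF Smod SSS.abelian_group_axioms] additive_mapI)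
            (auto simp: S_pure_closed[OF SSmod] S_pure_add_right[OF SSmod])
        finally show "SP ?SS (a i) (\<mu> (b i))
            = (\<Oplus>\<^bsub>?SSS\<^esub>j\<in>{..<n}. pure3 R S \<phi> (a i) (b i \<otimes>\<^bsub>S\<^esub> a j) (b j))" .
      qed (use a_closed b_closed S_pure_closed[OF SSmod] pure2_closed in
          \<open>auto intro!: SSS.finsum_closed\<close>)
      finally show ?thesis .
    qed
    ultimately show ?thesis by simp
  qed

  have "h_separability_idempotent R S \<phi> e"
    unfolding h_separability_idempotent_def
    by (rule exI[of _ n], rule exI[of _ a], rule exI[of _ b])
      (intro conjI ballI a b e_sum unit central heavy)
  then show ?thesis ..
qed

end

section \<open>The equivalence\<close>

theorem proposition3p4:
  fixes R :: "('r, 'x) ring_scheme"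
    and S :: "('s, 'y) ring_scheme"
    and \<phi> :: "'r \<Rightarrow> 's"
  assumes "ring R" and "ring S" and "\<phi> \<in> ring_hom R S"
    and universe_infinite: "infinite (UNIV :: 'u set)"
    and universe_contains_S: "\<exists>\<iota> :: 's \<Rightarrow> 'u. inj_on \<iota> (carrier S)"
  shows "h_separable_extension TYPE('u) R S \<phi> \<longleftrightarrow> (\<exists>e. h_separability_idempotent R S \<phi> e)"
proof -
  interpret ring_extension R S \<phi>
    using assms(1-3) by (intro ring_extension.intro ring_extension_axioms.intro)
  have "carrier S \<lesssim> (UNIV :: 'u set)"
    using universe_contains_S by (simp add: lepoll_def)
  then show ?thesis
    using retraction.idempotent_of_retraction universe_infinite retraction_of_idempotent
    unfolding h_separable_extension_iff_retraction by blast
qed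

end
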